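(* Let $(A,[~,\dots,~],a)$ be a Filippov algebroid of order $n$ over a smooth manifold $M$. A trivial deformation of $(A,[~,\dots,~],a)$ induces a Nijenhuis operator: if $A_t$ is a deformation generated by $\varphi_1,\dots,\varphi_{n-1}\in\mathrm{Der}^1(A)$ which is trivial through $\Phi_t=\mathrm{Id}+tN$, then the bundle map $N:A\to A$ is a Nijenhuis operator on $(A,[~,\dots,~],a)$. Conversely, if $N:A\to A$ is a Nijenhuis operator on $(A,[~,\dots,~],a)$, then the cochains $\varphi_1,\dots,\varphi_{n-1}\in\mathrm{Der}^1(A)$ defined by $\varphi_i(x_1,\dots,x_n)=[x_1,\dots,x_n]^i_N$ for $1\le i\le n-1$ generate a trivial deformation of $(A,[~,\dots,~],a)$.
   Context: Let $n\ge2$ be fixed, $M$ a smooth manifold, $\chi(M)$ the space of vector fields, $A\to M$ a smooth real vector bundle, $\Gamma A$ its space of smooth sections. A Filippov algebra of order $n$ is a real vector space $L$ with an $\mathbb R$-multilinear skew-symmetric bracket $[~,\dots,~]:L^{n}\to L$ satisfying $[a_1,\dots,a_{n-1},[b_1,\dots,b_n]]=\sum_{i=1}^n[b_1,\dots,b_{i-1},[a_1,\dots,a_{n-1},b_i],b_{i+1},\dots,b_n]$. A Filippov algebroid $(A,[~,\dots,~],a)$ of order $n$ over $M$ is a vector bundle $A$ with a Filippov algebra structure of order $n$ on $\Gamma A$ and a bundle map $a:\wedge^{n-1}A\to TM$ (the anchor) such that (a) $[a(x_1\wedge\cdots\wedge x_{n-1}),a(y_1\wedge\cdots\wedge y_{n-1})]=\sum_{i=1}^{n-1}a(y_1\wedge\cdots\wedge[x_1,\dots,x_{n-1},y_i]\wedge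 y_{i+1}\wedge\cdots\wedge y_{n-1})$, and (b) $[x_1,\dots,x_{n-1},fy]=f[x_1,\dots,x_{n-1},y]+a(x_1\wedge\cdots\wedge x_{n-1})(f)y$, for all $x_i,y_i,y\in\Gamma A$, $f\in C^\infty(M)$. Put $\mathcal L(A):=\Gamma A\wedge\cdots\wedge\Gamma A$ ($n-1$ copies); exterior powers are over $\mathbb R$; elements are written $X=X^1\wedge\cdots\wedge X^{n-1}$. $\mathrm{Der}^1(A)$ is the set of $\mathbb R$-linear maps $D:\mathcal L(A)\wedge\Gamma A\to\Gamma A$, written $D(X,z)$ or $D(x_1,\dots,x_n)$ (alternating in all $n$ sections), for which there is a map $\sigma_D:\mathcal L(A)\to\chi(M)$ (the symbol), $C^\infty(M)$-multilinear in the sections $X^j$, with $D(X,fz)=fD(X,z)+\sigma_D(X)(f)z$. A (one-parameter) deformation of $(A,[~,\dots,~],a)$ generated by $\varphi_1,\dots,\varphi_m\in\mathrm{Der}^1(A)$ is a family $A_t=(A,[~,\dots,~]_t,a_t)$, $t\in\mathbb R$, with $[x_1,\dots,x_n]_t=[x_1,\dots,x_n]+\sum_{i=1}^m t^i\varphi_i(x_1,\dots,x_n)$ and $a_t=a+\sum_{i=1}^mt^i\sigma_{\varphi_i}$, which is a Filippov algebroid of order $n$ for every $t\in\mathbb R$ (equivalently, $[\varphi_t,\varphi_t]=0$ for $\varphi_t=\varphi+\sum t^i\varphi_i$ in the graded Lie algebra of Filippov multiderivations, $\varphi$ being the original bracket). It is trivial if there is a vector bundle map $N:A\to A$ such that $\Phi_t=\mathrm{Id}+tN:A_t\to(A,[~,\dots,~],a)$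 is a family of Filippov algebroid homomorphisms, i.e. for all $t$ and all $x_i\in\Gamma A$: $\Phi_t([x_1,\dots,x_n]_t)=[\Phi_t(x_1),\dots,\Phi_t(x_n)]$ and $a(\Phi_t(x_1),\dots,\Phi_t(x_{n-1}))=a_t(x_1,\dots,x_{n-1})$. For a bundle map $N:A\to A$ define $n$-ary brackets $[~,\dots,~]^k_N$ on $\Gamma A$ inductively by $$[x_1,\dots,x_n]^1_N=\sum_{i=1}^n[x_1,\dots,N(x_i),\dots,x_n]-N[x_1,\dots,x_n],$$ and for $2\le k\le n-1$, $$[x_1,\dots,x_n]^k_N=\sum_{1\le i_1<\cdots<i_k\le n}[x_1,\dots,N(x_{i_1}),\dots,N(x_{i_k}),\dots,x_n]-N[x_1,\dots,x_n]^{k-1}_N.$$ $N$ is a Nijenhuis operator on $(A,[~,\dots,~],a)$ if $[Nx_1,\dots,Nx_n]=N\big([x_1,\dots,x_n]^{n-1}_N\big)$ for all $x_1,\dots,x_n\in\Gamma A$. *)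

theory Defs
  imports "HOL-Analysis.Analysis" "HOL-Library.Function_Algebras"
begin

section \<open>Functions as a real vector space; multilinear maps\<close>

instantiation "fun" :: (type, real_vector) real_vector
begin

definition scaleR_fun_def: "scaleR (c::real) f = (\<lambda>x. c *\<^sub>R f x)"

instance
  by standard (simp_all add: scaleR_fun_def fun_eq_iff scaleR_add_right scaleR_add_left)

end

lemma scaleR_fun_apply [simp]: "(c *\<^sub>R f) x = c *\<^sub>R f x"
  by (simp add: scaleR_fun_def)

definition tuples :: "nat \<Rightarrow> 'a set \<Rightarrow> 'a list set" where
  "tuples k V = {xs. length xs = k \<and> set xs \<subseteq> V}"

definition multilinear :: "nat \<Rightarrow> 'a::real_vector set \<Rightarrow> ('a list \<Rightarrow> 'b::real_vector) \<Rightarrow> bool" where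
  "multilinear k V F \<longleftrightarrow>
     (\<forall>xs\<in>tuples k V. \<forall>i<k. \<forall>y\<in>V. \<forall>z\<in>V. \<forall>c.
        F (xs[i := y + c *\<^sub>R z]) = F (xs[i := y]) + c *\<^sub>R F (xs[i := z]))"

definition skew :: "nat \<Rightarrow> 'a set \<Rightarrow> ('a list \<Rightarrow> 'b::uminus) \<Rightarrow> bool" where
  "skew k V F \<longleftrightarrow>
     (\<forall>xs\<in>tuples k V. \<forall>i j. i < j \<and> j < k \<longrightarrow> F (xs[i := xs ! j, j := xs ! i]) = - F xs)"


section \<open>Smooth functions on open subsets of \<open>\<real>\<^sup>d\<close>\<close>

definition partial_deriv :: "nat \<Rightarrow> ((nat \<Rightarrow> real) \<Rightarrow> real) \<Rightarrow> (nat \<Rightarrow> real) \<Rightarrow> real" where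
  "partial_deriv i g x = deriv (\<lambda>s. g (x(i := s))) (x i)"

text \<open>\<open>V\<close> is meant to be open in \<^term>\<open>Euclidean_space d\<close>, where points of \<open>\<real>\<^sup>d\<close> are the
  sequences vanishing from index \<open>d\<close> on (so \<open>d = 0\<close> is allowed).\<close>

primrec Ck_on :: "nat \<Rightarrow> nat \<Rightarrow> (nat \<Rightarrow> real) set \<Rightarrow> ((nat \<Rightarrow> real) \<Rightarrow> real) \<Rightarrow> bool" where
  "Ck_on 0 d V g \<longleftrightarrow> continuous_map (subtopology (Euclidean_space d) V) euclideanreal g"
| "Ck_on (Suc k) d V g \<longleftrightarrow>
     continuous_map (subtopology (Euclidean_space d) V) euclideanreal g \<and>
     (\<forall>i<d. (\<forall>x\<in>V. (\<lambda>s. g (x(i := s))) field_differentiable (at (x i))) \<and>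
            Ck_on k d V (partial_deriv i g))"

definition smooth_on_Rd :: "nat \<Rightarrow> (nat \<Rightarrow> real) set \<Rightarrow> ((nat \<Rightarrow> real) \<Rightarrow> real) \<Rightarrow> bool" where
  "smooth_on_Rd d V g \<longleftrightarrow> (\<forall>k. Ck_on k d V g)"


section \<open>Smooth manifolds\<close>

record 'm manifold =
  top_of :: "'m topology"
  mdim :: nat
  atlas :: "('m set \<times> ('m \<Rightarrow> nat \<Rightarrow> real)) set"

abbreviation points :: "'m manifold \<Rightarrow> 'm set" where
  "points M \<equiv> topspace (top_of M)"

definition smooth_manifold :: "'m manifold \<Rightarrow> bool" where
  "smooth_manifold M \<longleftrightarrow>
     Hausdorff_space (top_of M) \<and> second_countable (top_of M) \<and>
     (\<forall>(U, \<phi>)\<in>atlas M.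
        openin (top_of M) U \<and> openin (Euclidean_space (mdim M)) (\<phi> ` U) \<and>
        homeomorphic_map (subtopology (top_of M) U)
          (subtopology (Euclidean_space (mdim M)) (\<phi> ` U)) \<phi>) \<and>
     (\<forall>p\<in>points M. \<exists>(U, \<phi>)\<in>atlas M. p \<in> U) \<and>
     (\<forall>(U, \<phi>)\<in>atlas M. \<forall>(V, \<psi>)\<in>atlas M. \<forall>i<mdim M.
        smooth_on_Rd (mdim M) (\<phi> ` (U \<inter> V)) (\<lambda>x. \<psi> (inv_into U \<phi> x) i))"

definition smooth_fun_on :: "'m manifold \<Rightarrow> 'm set \<Rightarrow> ('m \<Rightarrow> real) \<Rightarrow> bool" where
  "smooth_fun_on M W f \<longleftrightarrow>
     (\<forall>(U, \<phi>)\<in>atlas M. smooth_on_Rd (mdim M) (\<phi> ` (U \<inter> W)) (\<lambda>x. f (inv_into U \<phi> x)))"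

text \<open>The values of \<open>f\<close> outside the manifold are irrelevant.\<close>

definition smooth_funs :: "'m manifold \<Rightarrow> ('m \<Rightarrow> real) set" where
  "smooth_funs M = {f. smooth_fun_on M (points M) f}"

text \<open>Tangent vectors at \<open>p\<close> are the derivations at \<open>p\<close> of the algebra of smooth functions;
  the last clause only fixes a default value, making such a derivation a unique HOL function.\<close>

definition tangent_space :: "'m manifold \<Rightarrow> 'm \<Rightarrow> (('m \<Rightarrow> real) \<Rightarrow> real) set" where
  "tangent_space M p = {v.
     (\<forall>f\<in>smooth_funs M. \<forall>g\<in>smooth_funs M. \<forall>c. v (f + c *\<^sub>R g) = v f + c * v g) \<and>
     (\<forall>f\<in>smooth_funs M. \<forall>g\<in>smooth_funs M. v (f * g) = f p * v g + g p * v f) \<and>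
     (\<forall>f. f \<notin> smooth_funs M \<longrightarrow> v f = 0)}"

type_synonym 'm vfield = "'m \<Rightarrow> ('m \<Rightarrow> real) \<Rightarrow> real"

definition smooth_vfield_on :: "'m manifold \<Rightarrow> 'm set \<Rightarrow> 'm vfield \<Rightarrow> bool" where
  "smooth_vfield_on M W X \<longleftrightarrow>
     (\<forall>p\<in>W. X p \<in> tangent_space M p) \<and>
     (\<forall>f\<in>smooth_funs M. smooth_fun_on M W (\<lambda>p. X p f))"

text \<open>Vector fields, and sections of bundles below, are extended by \<open>0\<close> outside the manifold.\<close>

definition vector_fields :: "'m manifold \<Rightarrow> 'm vfield set" where
  "vector_fields M = {X. smooth_vfield_on M (points M) X \<and> (\<forall>p. p \<notin> points M \<longrightarrow> X p = 0)}"

definition lie_bracket :: "'m vfield \<Rightarrow> 'm vfield \<Rightarrow> 'm vfield" where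
  "lie_bracket X Y = (\<lambda>p f. X p (\<lambda>q. Y q f) - Y p (\<lambda>q. X q f))"

definition fmult :: "('m \<Rightarrow> real) \<Rightarrow> ('m \<Rightarrow> 'w::real_vector) \<Rightarrow> 'm \<Rightarrow> 'w" where
  "fmult f s = (\<lambda>p. f p *\<^sub>R s p)"


section \<open>Smooth real vector bundles\<close>

text \<open>The fibre over \<open>p\<close> is a linear subspace \<open>fibre B p\<close> of a real vector space \<open>'v\<close>. No topology on
  \<open>'v\<close> is used, so this is not a restriction to subbundles of a trivial bundle: \<open>'v\<close> can be the
  direct sum of all the fibres. The smooth structure is given by local trivialisations, presented
  as local frames: \<open>(U, e)\<close> stands for \<open>(p, c) \<mapsto> \<Sum>i<r. c i *\<^sub>R e i p\<close>, identifying \<open>U \<times> \<real>\<^sup>r\<close>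
  with the restriction of the bundle to \<open>U\<close>.\<close>

record ('m, 'v) vbundle =
  base :: "'m manifold"
  fibre :: "'m \<Rightarrow> 'v set"
  brank :: nat
  frames :: "('m set \<times> (nat \<Rightarrow> 'm \<Rightarrow> 'v)) set"

definition smooth_section_on ::
    "('m, 'v::real_vector) vbundle \<Rightarrow> 'm set \<Rightarrow> ('m \<Rightarrow> 'v) \<Rightarrow> bool" where
  "smooth_section_on B W s \<longleftrightarrow>
     (\<forall>(U, e)\<in>frames B. \<exists>c.
        (\<forall>i<brank B. smooth_fun_on (base B) (U \<inter> W) (c i)) \<and>
        (\<forall>p\<in>U \<inter> W. s p = (\<Sum>i<brank B. c i p *\<^sub>R e i p)))"

text \<open>The last clause says that the transition functions between any two local trivialisations
  are smooth.\<close>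

definition vector_bundle :: "('m, 'v::real_vector) vbundle \<Rightarrow> bool" where
  "vector_bundle B \<longleftrightarrow>
     smooth_manifold (base B) \<and>
     (\<forall>(U, e)\<in>frames B.
        openin (top_of (base B)) U \<and>
        (\<forall>p\<in>U. inj_on (\<lambda>i. e i p) {..<brank B} \<and>
               independent ((\<lambda>i. e i p) ` {..<brank B}) \<and>
               span ((\<lambda>i. e i p) ` {..<brank B}) = fibre B p)) \<and>
     (\<forall>p\<in>points (base B). \<exists>(U, e)\<in>frames B. p \<in> U) \<and>
     (\<forall>(U, e)\<in>frames B. \<forall>j<brank B. smooth_section_on B U (e j))"

definition sections :: "('m, 'v::real_vector) vbundle \<Rightarrow> ('m \<Rightarrow> 'v) set" where
  "sections B =
     {s. smooth_section_on B (points (base B)) s \<and> (\<forall>p. p \<notin> points (base B) \<longrightarrow> s p = 0)}"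

text \<open>Vector bundle maps \<open>A \<rightarrow> A\<close> over the identity: fibrewise linear, smooth in the local
  trivialisations.\<close>

definition bundle_endo :: "('m, 'v::real_vector) vbundle \<Rightarrow> ('m \<Rightarrow> 'v \<Rightarrow> 'v) \<Rightarrow> bool" where
  "bundle_endo B N \<longleftrightarrow>
     (\<forall>p\<in>points (base B).
        (\<forall>u\<in>fibre B p. N p u \<in> fibre B p) \<and>
        (\<forall>u\<in>fibre B p. \<forall>w\<in>fibre B p. \<forall>c. N p (u + c *\<^sub>R w) = N p u + c *\<^sub>R N p w)) \<and>
     (\<forall>(U, e)\<in>frames B. \<forall>i<brank B. smooth_section_on B U (\<lambda>p. N p (e i p)))"

definition apply_endo ::
    "('m, 'v::real_vector) vbundle \<Rightarrow> ('m \<Rightarrow> 'v \<Rightarrow> 'v) \<Rightarrow> ('m \<Rightarrow> 'v) \<Rightarrow> 'm \<Rightarrow> 'v" where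
  "apply_endo B N s = (\<lambda>p. if p \<in> points (base B) then N p (s p) else 0)"

text \<open>Bundle maps \<open>\<And>\<^sup>k A \<rightarrow> TM\<close>, the linear maps on \<open>\<And>\<^sup>k A\<^sub>p\<close> being given as skew-symmetric
  multilinear maps on \<open>k\<close>-tuples from the fibre \<open>A\<^sub>p\<close>.\<close>

type_synonym ('m, 'v) anchor = "'m \<Rightarrow> 'v list \<Rightarrow> ('m \<Rightarrow> real) \<Rightarrow> real"

definition wedge_to_tangent ::
    "('m, 'v::real_vector) vbundle \<Rightarrow> nat \<Rightarrow> ('m, 'v) anchor \<Rightarrow> bool" where
  "wedge_to_tangent B k a \<longleftrightarrow>
     (\<forall>p\<in>points (base B).
        (\<forall>vs\<in>tuples k (fibre B p). a p vs \<in> tangent_space (base B) p) \<and>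
        multilinear k (fibre B p) (a p) \<and> skew k (fibre B p) (a p)) \<and>
     (\<forall>(U, e)\<in>frames B. \<forall>is\<in>tuples k {..<brank B}.
        smooth_vfield_on (base B) U (\<lambda>p. a p (map (\<lambda>i. e i p) is)))"

definition apply_anchor ::
    "('m, 'v::real_vector) vbundle \<Rightarrow> ('m, 'v) anchor \<Rightarrow> ('m \<Rightarrow> 'v) list \<Rightarrow> 'm vfield" where
  "apply_anchor B a xs = (\<lambda>p. if p \<in> points (base B) then a p (map (\<lambda>x. x p) xs) else 0)"


section \<open>Filippov algebroids\<close>

definition filippov_algebra :: "nat \<Rightarrow> 'l::real_vector set \<Rightarrow> ('l list \<Rightarrow> 'l) \<Rightarrow> bool" where
  "filippov_algebra n L br \<longleftrightarrow>
     subspace L \<and> (\<forall>xs\<in>tuples n L. br xs \<in> L) \<and> multilinear n L br \<and> skew n L br \<and>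
     (\<forall>xs\<in>tuples (n - 1) L. \<forall>ys\<in>tuples n L.
        br (xs @ [br ys]) = (\<Sum>i<n. br (ys[i := br (xs @ [ys ! i])])))"

type_synonym ('m, 'v) bracket = "('m \<Rightarrow> 'v) list \<Rightarrow> 'm \<Rightarrow> 'v"

definition filippov_algebroid ::
    "('m, 'v::real_vector) vbundle \<Rightarrow> nat \<Rightarrow> ('m, 'v) bracket \<Rightarrow> ('m, 'v) anchor \<Rightarrow> bool" where
  "filippov_algebroid B n br a \<longleftrightarrow>
     vector_bundle B \<and> filippov_algebra n (sections B) br \<and> wedge_to_tangent B (n - 1) a \<and>
     (\<forall>xs\<in>tuples (n - 1) (sections B). \<forall>ys\<in>tuples (n - 1) (sections B).
        lie_bracket (apply_anchor B a xs) (apply_anchor B a ys) =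
        (\<Sum>i<n - 1. apply_anchor B a (ys[i := br (xs @ [ys ! i])]))) \<and>
     (\<forall>xs\<in>tuples (n - 1) (sections B). \<forall>y\<in>sections B. \<forall>f\<in>smooth_funs (base B).
        br (xs @ [fmult f y]) =
        fmult f (br (xs @ [y])) + fmult (\<lambda>p. apply_anchor B a xs p f) y)"

definition filippov_hom ::
    "('m, 'v::real_vector) vbundle \<Rightarrow> nat \<Rightarrow> ('m \<Rightarrow> 'v \<Rightarrow> 'v) \<Rightarrow>
     ('m, 'v) bracket \<Rightarrow> ('m, 'v) anchor \<Rightarrow> ('m, 'v) bracket \<Rightarrow> ('m, 'v) anchor \<Rightarrow> bool" where
  "filippov_hom B n \<Phi> br1 a1 br2 a2 \<longleftrightarrow>
     bundle_endo B \<Phi> \<and>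
     (\<forall>xs\<in>tuples n (sections B).
        apply_endo B \<Phi> (br1 xs) = br2 (map (apply_endo B \<Phi>) xs)) \<and>
     (\<forall>xs\<in>tuples (n - 1) (sections B).
        apply_anchor B a2 (map (apply_endo B \<Phi>) xs) = apply_anchor B a1 xs)"


section \<open>\<open>Der\<^sup>1(A)\<close>, deformations and Nijenhuis operators\<close>

text \<open>The symbol is determined by \<open>D\<close> on tuples of sections (evaluate on sections that do not
  vanish at a given point), but is a junk value elsewhere; hence a relation.\<close>

definition has_symbol ::
    "('m, 'v::real_vector) vbundle \<Rightarrow> nat \<Rightarrow> ('m, 'v) bracket \<Rightarrow>
     (('m \<Rightarrow> 'v) list \<Rightarrow> 'm vfield) \<Rightarrow> bool" where
  "has_symbol B n D \<sigma> \<longleftrightarrow>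
     (\<forall>xs\<in>tuples (n - 1) (sections B). \<sigma> xs \<in> vector_fields (base B)) \<and>
     skew (n - 1) (sections B) \<sigma> \<and>
     (\<forall>xs\<in>tuples (n - 1) (sections B). \<forall>i<n - 1. \<forall>y\<in>sections B. \<forall>z\<in>sections B.
        \<forall>f\<in>smooth_funs (base B).
        \<sigma> (xs[i := y + fmult f z]) = \<sigma> (xs[i := y]) + fmult f (\<sigma> (xs[i := z]))) \<and>
     (\<forall>xs\<in>tuples (n - 1) (sections B). \<forall>z\<in>sections B. \<forall>f\<in>smooth_funs (base B).
        D (xs @ [fmult f z]) = fmult f (D (xs @ [z])) + fmult (\<lambda>p. \<sigma> xs p f) z)"

definition Der1 :: "('m, 'v::real_vector) vbundle \<Rightarrow> nat \<Rightarrow> ('m, 'v) bracket set" where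
  "Der1 B n = {D.
     (\<forall>xs\<in>tuples n (sections B). D xs \<in> sections B) \<and>
     multilinear n (sections B) D \<and> skew n (sections B) D \<and> (\<exists>\<sigma>. has_symbol B n D \<sigma>)}"

definition deformed_bracket ::
    "('m, 'v::real_vector) bracket \<Rightarrow> nat \<Rightarrow> (nat \<Rightarrow> ('m, 'v) bracket) \<Rightarrow> real \<Rightarrow>
     ('m, 'v) bracket" where
  "deformed_bracket br m \<phi> t = (\<lambda>xs. br xs + (\<Sum>i=1..m. t ^ i *\<^sub>R \<phi> i xs))"

text \<open>The family \<open>A\<^sub>t\<close> is given by the generators \<open>\<phi>\<^sub>1, \<dots>, \<phi>\<^sub>m\<close> and the anchors \<open>a\<^sub>t = aa t\<close>, which
  are bundle maps inducing \<open>a + \<Sum>i t\<^sup>i \<sigma>\<^sub>i\<close> on sections, \<open>\<sigma>\<^sub>i\<close> being the symbol of \<open>\<phi>\<^sub>i\<close>.\<close>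

definition deformation ::
    "('m, 'v::real_vector) vbundle \<Rightarrow> nat \<Rightarrow> ('m, 'v) bracket \<Rightarrow> ('m, 'v) anchor \<Rightarrow>
     nat \<Rightarrow> (nat \<Rightarrow> ('m, 'v) bracket) \<Rightarrow> (real \<Rightarrow> ('m, 'v) anchor) \<Rightarrow> bool" where
  "deformation B n br a m \<phi> aa \<longleftrightarrow>
     (\<forall>i\<in>{1..m}. \<phi> i \<in> Der1 B n) \<and>
     (\<exists>\<sigma>. (\<forall>i\<in>{1..m}. has_symbol B n (\<phi> i) (\<sigma> i)) \<and>
          (\<forall>t. \<forall>xs\<in>tuples (n - 1) (sections B).
             apply_anchor B (aa t) xs = apply_anchor B a xs + (\<Sum>i=1..m. t ^ i *\<^sub>R \<sigma> i xs))) \<and>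
     (\<forall>t. filippov_algebroid B n (deformed_bracket br m \<phi> t) (aa t))"

definition id_plus :: "real \<Rightarrow> ('m \<Rightarrow> 'v::real_vector \<Rightarrow> 'v) \<Rightarrow> 'm \<Rightarrow> 'v \<Rightarrow> 'v" where
  "id_plus t N = (\<lambda>p v. v + t *\<^sub>R N p v)"

definition trivial_through ::
    "('m, 'v::real_vector) vbundle \<Rightarrow> nat \<Rightarrow> ('m, 'v) bracket \<Rightarrow> ('m, 'v) anchor \<Rightarrow>
     nat \<Rightarrow> (nat \<Rightarrow> ('m, 'v) bracket) \<Rightarrow> (real \<Rightarrow> ('m, 'v) anchor) \<Rightarrow>
     ('m \<Rightarrow> 'v \<Rightarrow> 'v) \<Rightarrow> bool" where
  "trivial_through B n br a m \<phi> aa N \<longleftrightarrow>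
     bundle_endo B N \<and>
     (\<forall>t. filippov_hom B n (id_plus t N) (deformed_bracket br m \<phi> t) (aa t) br a)"

definition trivial_deformation ::
    "('m, 'v::real_vector) vbundle \<Rightarrow> nat \<Rightarrow> ('m, 'v) bracket \<Rightarrow> ('m, 'v) anchor \<Rightarrow>
     nat \<Rightarrow> (nat \<Rightarrow> ('m, 'v) bracket) \<Rightarrow> (real \<Rightarrow> ('m, 'v) anchor) \<Rightarrow> bool" where
  "trivial_deformation B n br a m \<phi> aa \<longleftrightarrow>
     deformation B n br a m \<phi> aa \<and> (\<exists>N. trivial_through B n br a m \<phi> aa N)"

definition insert_endo ::
    "('m, 'v::real_vector) vbundle \<Rightarrow> ('m \<Rightarrow> 'v \<Rightarrow> 'v) \<Rightarrow> nat set \<Rightarrow>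
     ('m \<Rightarrow> 'v) list \<Rightarrow> ('m \<Rightarrow> 'v) list" where
  "insert_endo B N I xs =
     map (\<lambda>i. if i \<in> I then apply_endo B N (xs ! i) else xs ! i) [0..<length xs]"

text \<open>With the original bracket as value at \<open>k = 0\<close>, the case \<open>k = 1\<close> is an instance of the
  recursion.\<close>

primrec nij_bracket ::
    "('m, 'v::real_vector) vbundle \<Rightarrow> nat \<Rightarrow> ('m, 'v) bracket \<Rightarrow> ('m \<Rightarrow> 'v \<Rightarrow> 'v) \<Rightarrow>
     nat \<Rightarrow> ('m, 'v) bracket" where
  "nij_bracket B n br N 0 = br"
| "nij_bracket B n br N (Suc k) =
     (\<lambda>xs. (\<Sum>I\<in>{I. I \<subseteq> {..<n} \<and> card I = Suc k}. br (insert_endo B N I xs))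
           - apply_endo B N (nij_bracket B n br N k xs))"

definition nijenhuis_operator ::
    "('m, 'v::real_vector) vbundle \<Rightarrow> nat \<Rightarrow> ('m, 'v) bracket \<Rightarrow> ('m \<Rightarrow> 'v \<Rightarrow> 'v) \<Rightarrow> bool" where
  "nijenhuis_operator B n br N \<longleftrightarrow>
     bundle_endo B N \<and>
     (\<forall>xs\<in>tuples n (sections B).
        br (map (apply_endo B N) xs) = apply_endo B N (nij_bracket B n br N (n - 1) xs))"

end

theory Submission
  imports Defs
begin

text \<open>Write \<open>\<Phi>\<^sub>t = Id + t N\<close>. By multilinearity \<open>[\<Phi>\<^sub>t x\<^sub>1, \<dots>, \<Phi>\<^sub>t x\<^sub>n]\<close> is a polynomial of degree \<open>n\<close> in \<open>t\<close>
  whose \<open>k\<close>-th coefficient is the sum of the brackets with \<open>N\<close> inserted in \<open>k\<close> places. Comparing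
  coefficients in \<open>\<Phi>\<^sub>t [x\<^sub>1, \<dots>, x\<^sub>n]\<^sub>t = [\<Phi>\<^sub>t x\<^sub>1, \<dots>, \<Phi>\<^sub>t x\<^sub>n]\<close> forces \<open>\<phi>\<^sub>k = [\<dots>]\<^sup>k\<^sub>N\<close> for \<open>k < n\<close>, and the
  coefficient of \<open>t\<^sup>n\<close> is the Nijenhuis condition; conversely the Nijenhuis condition makes
  \<open>\<Phi>\<^sub>t\<close> intertwine the brackets. Every identity required of the deformed structure then holds
  after applying \<open>\<Phi>\<^sub>t\<close>, by the corresponding identity of the original one. Although \<open>\<Phi>\<^sub>t\<close> may fail to
  be injective for a particular \<open>t\<close>, a polynomial \<open>P(t)\<close> with \<open>\<Phi>\<^sub>t (P(t)) = 0\<close> for all \<open>t\<close> vanishes,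
  so \<open>\<Phi>\<^sub>t\<close> can be cancelled. The anchors are \<open>a\<^sub>t = a \<circ> \<And>\<^sup>n\<^sup>-\<^sup>1 \<Phi>\<^sub>t\<close>.\<close>

section \<open>Smooth functions\<close>

lemma line_eventually_in_open:
  assumes "openin (Euclidean_space d) V" "x \<in> V" "i < d"
  shows "eventually (\<lambda>s. x(i := s) \<in> V) (nhds (x i))"
proof -
  have xt: "x \<in> topspace (Euclidean_space d)"
    using assms openin_subset by blast
  have "continuous_map euclideanreal (Euclidean_space d) (\<lambda>s. x(i := s))"
    unfolding Euclidean_space_def continuous_map_in_subtopology
  proof
    show "continuous_map euclideanreal (powertop_real UNIV) (\<lambda>s. x(i := s))"
      by (subst continuous_map_componentwise_UNIV) (auto simp: fun_upd_def)
    show "(\<lambda>s. x(i := s)) \<in> topspace euclideanreal \<rightarrow> {x. \<forall>i\<ge>d. x i = 0}"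
      using xt assms(3) by (auto simp: topspace_Euclidean_space)
  qed
  then have "open {s. x(i := s) \<in> V}"
    using openin_continuous_map_preimage[OF _ assms(1)] by fastforce
  then show ?thesis
    using assms(2) by (auto simp: eventually_nhds intro!: exI[of _ "{s. x(i := s) \<in> V}"])
qed

text \<open>Chart expressions are total functions with arbitrary values off V. A partial derivative
  at a point of V sees only a short coordinate segment, which stays in V by openness, so agreement
  on V passes to partial derivatives and the induction on \<open>k\<close> runs.\<close>

lemma Ck_on_cong:
  assumes V: "openin (Euclidean_space d) V"
  shows "Ck_on k d V g \<Longrightarrow> (\<And>x. x \<in> V \<Longrightarrow> g x = h x) \<Longrightarrow> Ck_on k d V h"
proof (induction k arbitrary: g h)
  case 0
  then show ?case by (auto intro: continuous_map_eq)
next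
  case (Suc k)
  have ev: "\<forall>\<^sub>F s in nhds (x i). g (x(i := s)) = h (x(i := s))" if "x \<in> V" "i < d" for x i
    using line_eventually_in_open[OF V that] by eventually_elim (use Suc.prems in auto)
  have "partial_deriv i g x = partial_deriv i h x" if "x \<in> V" "i < d" for x i
    unfolding partial_deriv_def by (rule deriv_cong_ev[OF ev[OF that]]) simp
  moreover have "(\<lambda>s. h (x(i := s))) field_differentiable at (x i)" if "x \<in> V" "i < d" for x i
    using Suc.prems(1) that
    by (simp add: field_differentiable_def DERIV_cong_ev[OF refl ev[OF that] refl, symmetric])
  ultimately show ?case
    using Suc.prems Suc.IH[of "partial_deriv _ g" "partial_deriv _ h"]
    by (auto intro: continuous_map_eq)
qed

lemma Ck_on_continuous:
  "Ck_on k d V g \<Longrightarrow> continuous_map (subtopology (Euclidean_space d) V) euclideanreal g"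
  by (cases k) auto

lemma Ck_on_Suc: "Ck_on (Suc k) d V g \<Longrightarrow> Ck_on k d V g"
proof (induction k arbitrary: g)
  case (Suc k)
  then show ?case unfolding Ck_on.simps(2)[of "Suc k"] by (auto simp: Ck_on_continuous)
qed simp

lemma Ck_on_subset: "Ck_on k d V g \<Longrightarrow> W \<subseteq> V \<Longrightarrow> Ck_on k d W g"
  by (induction k arbitrary: g) (auto intro: continuous_map_from_subtopology_mono)

text \<open>Each clause of \<open>Ck_on\<close> is local: continuity glues by pasting,
  differentiability is stated pointwise, and \<open>partial_deriv i g\<close> does not depend on the
  domain, so the induction hypothesis applies to it with the same neighbourhoods.\<close>

lemma Ck_on_local:
  assumes "\<And>x. x \<in> V \<Longrightarrow> \<exists>W. x \<in> W \<and> openin (Euclidean_space d) W \<and> W \<subseteq> V \<and> Ck_on k d W g"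
  shows "Ck_on k d V g"
proof -
  have cont: "continuous_map (subtopology (Euclidean_space d) V) euclideanreal g"
    if "\<And>x. x \<in> V \<Longrightarrow> \<exists>W. x \<in> W \<and> openin (Euclidean_space d) W \<and> W \<subseteq> V \<and>
      continuous_map (subtopology (Euclidean_space d) W) euclideanreal g" for g
  proof -
    have "\<exists>W. \<forall>x\<in>V. x \<in> W x \<and> openin (Euclidean_space d) (W x) \<and> W x \<subseteq> V \<and>
      continuous_map (subtopology (Euclidean_space d) (W x)) euclideanreal g"
      by (intro bchoice ballI that)
    then obtain W where W: "\<And>x. x \<in> V \<Longrightarrow> x \<in> W x \<and> openin (Euclidean_space d) (W x) \<and> W x \<subseteq> V \<and>
      continuous_map (subtopology (Euclidean_space d) (W x)) euclideanreal g"
      by blast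
    show ?thesis
    proof (rule pasting_lemma[where I = V and T = W and f = "\<lambda>_. g"])
      fix x assume "x \<in> V"
      then show "openin (subtopology (Euclidean_space d) V) (W x)"
        using W by (auto simp: openin_subtopology)
      show "continuous_map (subtopology (subtopology (Euclidean_space d) V) (W x)) euclideanreal g"
        using W \<open>x \<in> V\<close> by (simp add: subtopology_subtopology Int_absorb1)
    qed (use W in auto)
  qed
  show ?thesis using assms
  proof (induction k arbitrary: g)
    case 0
    then show ?case using cont[of g] by simp
  next
    case (Suc k)
    show ?case unfolding Ck_on.simps(2)
    proof (intro conjI allI impI ballI)
      show "continuous_map (subtopology (Euclidean_space d) V) euclideanreal g"
        using Suc.prems by (intro cont) (blast intro: Ck_on_continuous)
      fix i assume "i < d"
      then show "Ck_on k d V (partial_deriv i g)"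
        using Suc.prems by (intro Suc.IH) (fastforce simp: Ck_on.simps(2))
      fix x assume "x \<in> V"
      then show "(\<lambda>s. g (x(i := s))) field_differentiable at (x i)"
        using Suc.prems[of x] \<open>i < d\<close> by auto
    qed
  qed
qed

lemma Ck_on_const: "Ck_on k d V (\<lambda>x. c)"
proof (induction k arbitrary: c)
  case (Suc k)
  have "partial_deriv i (\<lambda>x. c) = (\<lambda>x. 0)" for i
    by (simp add: partial_deriv_def fun_eq_iff)
  then show ?case using Suc by simp
qed simp

lemma Ck_on_add:
  assumes V: "openin (Euclidean_space d) V"
  shows "Ck_on k d V g \<Longrightarrow> Ck_on k d V h \<Longrightarrow> Ck_on k d V (\<lambda>x. g x + h x)"
proof (induction k arbitrary: g h)
  case 0
  then show ?case by (auto intro: continuous_map_add)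
next
  case (Suc k)
  have D: "((\<lambda>s. g (x(i := s)) + h (x(i := s))) has_field_derivative
      partial_deriv i g x + partial_deriv i h x) (at (x i))"
    if "x \<in> V" "i < d" for x i
    using Suc.prems that unfolding partial_deriv_def
    by (intro DERIV_add) (auto simp: DERIV_deriv_iff_field_differentiable)
  then have "partial_deriv i (\<lambda>x. g x + h x) x = partial_deriv i g x + partial_deriv i h x"
    if "x \<in> V" "i < d" for x i
    using that by (auto simp: partial_deriv_def[of _ "\<lambda>x. g x + h x"] intro!: DERIV_imp_deriv)
  moreover have "Ck_on k d V (\<lambda>x. partial_deriv i g x + partial_deriv i h x)"
    if "i < d" for i
    using Suc.prems that by (intro Suc.IH) simp_all
  ultimately have "Ck_on k d V (partial_deriv i (\<lambda>x. g x + h x))" if "i < d" for i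
    using that Ck_on_cong[OF V, where g = "\<lambda>x. partial_deriv i g x + partial_deriv i h x"]
    by presburger
  moreover have "continuous_map (subtopology (Euclidean_space d) V) euclideanreal (\<lambda>x. g x + h x)"
    using Suc.prems by (intro continuous_map_add) simp_all
  ultimately show ?case
    using D unfolding Ck_on.simps(2) field_differentiable_def by blast
qed

lemma Ck_on_mult:
  assumes V: "openin (Euclidean_space d) V"
  shows "Ck_on k d V g \<Longrightarrow> Ck_on k d V h \<Longrightarrow> Ck_on k d V (\<lambda>x. g x * h x)"
proof (induction k arbitrary: g h)
  case 0
  then show ?case by (auto intro: continuous_map_real_mult)
next
  case (Suc k)
  have D: "((\<lambda>s. g (x(i := s)) * h (x(i := s))) has_field_derivative
      partial_deriv i g x * h x + partial_deriv i h x * g x) (at (x i))"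
    if "x \<in> V" "i < d" for x i
    using Suc.prems that unfolding partial_deriv_def
    by (auto intro!: derivative_eq_intros simp: DERIV_deriv_iff_field_differentiable)
  then have "partial_deriv i (\<lambda>x. g x * h x) x = partial_deriv i g x * h x + partial_deriv i h x * g x"
    if "x \<in> V" "i < d" for x i
    using that by (auto simp: partial_deriv_def[of _ "\<lambda>x. g x * h x"] intro!: DERIV_imp_deriv)
  \<comment> \<open>The product rule keeps undifferentiated factors; \<open>Ck_on_Suc\<close> lowers
    their order so that the induction hypothesis covers the mixed products.\<close>
  moreover have "Ck_on k d V (\<lambda>x. partial_deriv i g x * h x + partial_deriv i h x * g x)"
    if "i < d" for i
    using Suc.prems(1)[unfolded Ck_on.simps] Suc.prems(2)[unfolded Ck_on.simps] that
      Ck_on_Suc[OF Suc.prems(1)] Ck_on_Suc[OF Suc.prems(2)]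
    by (intro Ck_on_add[OF V] Suc.IH) blast+
  ultimately have "Ck_on k d V (partial_deriv i (\<lambda>x. g x * h x))" if "i < d" for i
    using that Ck_on_cong[OF V,
        where g = "\<lambda>x. partial_deriv i g x * h x + partial_deriv i h x * g x"]
    by presburger
  moreover have "continuous_map (subtopology (Euclidean_space d) V) euclideanreal (\<lambda>x. g x * h x)"
    using Suc.prems by (intro continuous_map_real_mult) simp_all
  ultimately show ?case
    using D unfolding Ck_on.simps(2) field_differentiable_def by blast
qed

section \<open>Smooth functions on manifolds\<close>

lemma chart_image_open:
  assumes "smooth_manifold M" "(U, \<phi>) \<in> atlas M" "openin (top_of M) W"
  shows "openin (Euclidean_space (mdim M)) (\<phi> ` (U \<inter> W))"
proof -
  have U: "openin (top_of M) U" "openin (Euclidean_space (mdim M)) (\<phi> ` U)"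
    and h: "homeomorphic_map (subtopology (top_of M) U)
          (subtopology (Euclidean_space (mdim M)) (\<phi> ` U)) \<phi>"
    using assms(1,2) unfolding smooth_manifold_def by auto
  have "openin (subtopology (top_of M) U) (U \<inter> W)"
    using assms(3) by (auto simp: openin_subtopology)
  then have "openin (subtopology (Euclidean_space (mdim M)) (\<phi> ` U)) (\<phi> ` (U \<inter> W))"
    using h by (auto simp: homeomorphic_map_openness_eq)
  then show ?thesis using U(2) openin_trans_full by blast
qed

lemma chart_inj:
  assumes "smooth_manifold M" "(U, \<phi>) \<in> atlas M"
  shows "inj_on \<phi> U"
proof -
  have U: "openin (top_of M) U"
    and h: "homeomorphic_map (subtopology (top_of M) U)
          (subtopology (Euclidean_space (mdim M)) (\<phi> ` U)) \<phi>"
    using assms unfolding smooth_manifold_def by auto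
  from homeomorphic_imp_injective_map[OF h] show ?thesis
    using openin_subset[OF U] by (simp add: Int_absorb1)
qed

lemma smooth_fun_on_subset:
  "smooth_fun_on M V f \<Longrightarrow> W \<subseteq> V \<Longrightarrow> smooth_fun_on M W f"
  unfolding smooth_fun_on_def smooth_on_Rd_def
  by (clarify, rule Ck_on_subset[of _ _ "_ ` (_ \<inter> V)"]) auto

lemma smooth_fun_on_const: "smooth_fun_on M W (\<lambda>p. c)"
  by (auto simp: smooth_fun_on_def smooth_on_Rd_def Ck_on_const)

lemma smooth_fun_on_add:
  assumes "smooth_manifold M" "openin (top_of M) W" "smooth_fun_on M W f" "smooth_fun_on M W g"
  shows "smooth_fun_on M W (\<lambda>p. f p + g p)"
  unfolding smooth_fun_on_def smooth_on_Rd_def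
  using assms(3,4)[unfolded smooth_fun_on_def smooth_on_Rd_def]
  by (auto intro!: Ck_on_add chart_image_open[OF assms(1) _ assms(2)])

lemma smooth_fun_on_mult:
  assumes "smooth_manifold M" "openin (top_of M) W" "smooth_fun_on M W f" "smooth_fun_on M W g"
  shows "smooth_fun_on M W (\<lambda>p. f p * g p)"
  unfolding smooth_fun_on_def smooth_on_Rd_def
  using assms(3,4)[unfolded smooth_fun_on_def smooth_on_Rd_def]
  by (auto intro!: Ck_on_mult chart_image_open[OF assms(1) _ assms(2)])

lemma smooth_fun_on_sum:
  assumes "smooth_manifold M" "openin (top_of M) W" "\<And>i. i \<in> I \<Longrightarrow> smooth_fun_on M W (f i)"
  shows "smooth_fun_on M W (\<lambda>p. \<Sum>i\<in>I. f i p)"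
  using assms(3)
  by (induction I rule: infinite_finite_induct)
    (auto simp: smooth_fun_on_const intro!: smooth_fun_on_add assms(1,2))

lemma smooth_fun_on_cong:
  assumes M: "smooth_manifold M" and W: "openin (top_of M) W"
    and f: "smooth_fun_on M W f" and eq: "\<And>p. p \<in> W \<Longrightarrow> f p = g p"
  shows "smooth_fun_on M W g"
  unfolding smooth_fun_on_def smooth_on_Rd_def
proof clarify
  fix U \<phi> k assume U: "(U, \<phi>) \<in> atlas M"
  have "Ck_on k (mdim M) (\<phi> ` (U \<inter> W)) (\<lambda>x. f (inv_into U \<phi> x))"
    using f U by (auto simp: smooth_fun_on_def smooth_on_Rd_def)
  then show "Ck_on k (mdim M) (\<phi> ` (U \<inter> W)) (\<lambda>x. g (inv_into U \<phi> x))"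
    by (rule Ck_on_cong[OF chart_image_open[OF M U W]])
      (use chart_inj[OF M U] in \<open>auto simp: eq\<close>)
qed

text \<open>Serves to glue results proved on the domains of local frames. Chart images of the open
  sets \<open>Q\<close> are open, which reduces the claim to \<open>Ck_on_local\<close>.\<close>

lemma smooth_fun_on_local:
  assumes M: "smooth_manifold M"
    and cov: "\<And>p. p \<in> W \<Longrightarrow>
      \<exists>Q. p \<in> Q \<and> openin (top_of M) Q \<and> Q \<subseteq> W \<and> smooth_fun_on M Q f"
  shows "smooth_fun_on M W f"
  unfolding smooth_fun_on_def smooth_on_Rd_def
proof clarify
  fix U \<phi> k assume U: "(U, \<phi>) \<in> atlas M"
  show "Ck_on k (mdim M) (\<phi> ` (U \<inter> W)) (\<lambda>x. f (inv_into U \<phi> x))"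
  proof (rule Ck_on_local)
    fix x assume "x \<in> \<phi> ` (U \<inter> W)"
    then obtain p where p: "p \<in> U" "p \<in> W" "x = \<phi> p" by auto
    with cov obtain Q where "p \<in> Q" "openin (top_of M) Q" "Q \<subseteq> W" "smooth_fun_on M Q f"
      by blast
    then show "\<exists>W'. x \<in> W' \<and> openin (Euclidean_space (mdim M)) W' \<and> W' \<subseteq> \<phi> ` (U \<inter> W) \<and>
        Ck_on k (mdim M) W' (\<lambda>x. f (inv_into U \<phi> x))"
      using p U chart_image_open[OF M U]
      by (intro exI[of _ "\<phi> ` (U \<inter> Q)"]) (auto simp: smooth_fun_on_def smooth_on_Rd_def)
  qed
qed


section \<open>Sections, bundle maps and anchors\<close>

lemma sum_fun_apply: "(\<Sum>i\<in>I. f i) x = (\<Sum>i\<in>I. f i x)"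
  by (induction I rule: infinite_finite_induct) auto

lemma multilinearD:
  "multilinear k V F \<Longrightarrow> xs \<in> tuples k V \<Longrightarrow> i < k \<Longrightarrow> y \<in> V \<Longrightarrow> z \<in> V \<Longrightarrow>
    F (xs[i := y + c *\<^sub>R z]) = F (xs[i := y]) + c *\<^sub>R F (xs[i := z])"
  by (simp add: multilinear_def)

lemma skewD:
  "skew k V F \<Longrightarrow> xs \<in> tuples k V \<Longrightarrow> i < j \<Longrightarrow> j < k \<Longrightarrow>
    F (xs[i := xs ! j, j := xs ! i]) = - F xs"
  by (simp add: skew_def)

lemma tuples_update [intro]: "xs \<in> tuples k V \<Longrightarrow> y \<in> V \<Longrightarrow> xs[i := y] \<in> tuples k V"
  using set_update_subset_insert[of xs i y] by (auto simp: tuples_def)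

lemma tuples_nth [intro]: "xs \<in> tuples k V \<Longrightarrow> i < k \<Longrightarrow> xs ! i \<in> V"
  by (auto simp: tuples_def)

lemma tuples_snoc: "xs \<in> tuples (n - 1) V \<Longrightarrow> y \<in> V \<Longrightarrow> 0 < n \<Longrightarrow> xs @ [y] \<in> tuples n V"
  by (auto simp: tuples_def)

lemma tuples_map: "xs \<in> tuples k V \<Longrightarrow> (\<And>x. x \<in> V \<Longrightarrow> f x \<in> W) \<Longrightarrow> map f xs \<in> tuples k W"
  by (auto simp: tuples_def)

text \<open>With y = z = 0 and c = -1 the single clause of \<open>multilinear\<close> reads F(0) =
  F(0) - F(0) in slot \<open>i\<close>. The same choice gives the other lemmas on values at
  0.\<close>

lemma multilinear_zero:
  assumes "multilinear k V F" "xs \<in> tuples k V" "i < k" "0 \<in> V"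
  shows "F (xs[i := 0]) = 0"
  using multilinearD[OF assms(1-3) assms(4,4), of "-1"] by simp

lemma multilinear_sum:
  assumes F: "multilinear k V F" "xs \<in> tuples k V" "i < k" and V: "subspace V"
    and v: "\<And>j. j \<in> J \<Longrightarrow> v j \<in> V"
  shows "F (xs[i := (\<Sum>j\<in>J. c j *\<^sub>R v j)]) = (\<Sum>j\<in>J. c j *\<^sub>R F (xs[i := v j]))"
  using v
proof (induction J rule: infinite_finite_induct)
  case (insert x J)
  have "(\<Sum>j\<in>J. c j *\<^sub>R v j) \<in> V"
    using insert.prems by (intro subspace_sum[OF V] subspace_scale[OF V]) auto
  with insert multilinearD[OF F this, of "v x" "c x"] show ?case
    by (simp add: add.commute)
qed (use multilinear_zero[OF F subspace_0[OF V]] in auto)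

section \<open>Local frames and smooth sections\<close>

lemma frame_open: "vector_bundle B \<Longrightarrow> (U, e) \<in> frames B \<Longrightarrow> openin (top_of (base B)) U"
  by (auto simp: vector_bundle_def)

lemma frame_span:
  "vector_bundle B \<Longrightarrow> (U, e) \<in> frames B \<Longrightarrow> p \<in> U \<Longrightarrow>
    span ((\<lambda>i. e i p) ` {..<brank B}) = fibre B p"
  by (fastforce simp: vector_bundle_def)

lemma frame_in_fibre:
  "vector_bundle B \<Longrightarrow> (U, e) \<in> frames B \<Longrightarrow> p \<in> U \<Longrightarrow> i < brank B \<Longrightarrow> e i p \<in> fibre B p"
  by (subst frame_span[symmetric]) (auto intro: span_base)

lemma frame_smooth:
  "vector_bundle B \<Longrightarrow> (U, e) \<in> frames B \<Longrightarrow> i < brank B \<Longrightarrow> smooth_section_on B U (e i)"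
  by (auto simp: vector_bundle_def)

lemma frame_at:
  assumes "vector_bundle B" "p \<in> points (base B)"
  obtains U e where "(U, e) \<in> frames B" "p \<in> U"
  using assms by (force simp: vector_bundle_def)

lemma fibre_subspace: "vector_bundle B \<Longrightarrow> p \<in> points (base B) \<Longrightarrow> subspace (fibre B p)"
  using frame_at frame_span subspace_span by metis

lemma base_manifold: "vector_bundle B \<Longrightarrow> smooth_manifold (base B)"
  by (simp add: vector_bundle_def)

lemma smooth_section_coeffs:
  assumes "smooth_section_on B W s" "(U, e) \<in> frames B"
  obtains c where "\<And>i. i < brank B \<Longrightarrow> smooth_fun_on (base B) (U \<inter> W) (c i)"
    and "\<And>p. p \<in> U \<Longrightarrow> p \<in> W \<Longrightarrow> s p = (\<Sum>i<brank B. c i p *\<^sub>R e i p)"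
  using bspec[OF assms(1)[unfolded smooth_section_on_def] assms(2)] by auto

lemma smooth_section_onI:
  assumes "\<And>U e. (U, e) \<in> frames B \<Longrightarrow>
    \<exists>c. (\<forall>i<brank B. smooth_fun_on (base B) (U \<inter> W) (c i)) \<and>
        (\<forall>p\<in>U \<inter> W. s p = (\<Sum>i<brank B. c i p *\<^sub>R e i p))"
  shows "smooth_section_on B W s"
  using assms unfolding smooth_section_on_def by auto

lemma smooth_section_in_fibre:
  assumes B: "vector_bundle B" and s: "smooth_section_on B W s"
    and p: "p \<in> W" "p \<in> points (base B)"
  shows "s p \<in> fibre B p"
proof -
  obtain U e where U: "(U, e) \<in> frames B" "p \<in> U"
    using frame_at[OF B p(2)] .
  obtain c where "s p = (\<Sum>i<brank B. c i p *\<^sub>R e i p)"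
    using smooth_section_coeffs[OF s U(1)] U(2) p(1) by metis
  then show ?thesis
    using frame_in_fibre[OF B U] fibre_subspace[OF B p(2)]
    by (auto intro!: subspace_sum subspace_scale)
qed

lemma smooth_section_on_add:
  assumes B: "vector_bundle B" and W: "openin (top_of (base B)) W"
    and "smooth_section_on B W s" "smooth_section_on B W s'"
  shows "smooth_section_on B W (\<lambda>p. s p + s' p)"
proof (rule smooth_section_onI)
  fix U e assume U: "(U, e) \<in> frames B"
  have UW: "openin (top_of (base B)) (U \<inter> W)"
    using frame_open[OF B U] W by auto
  obtain c where c:
    "\<And>i. i < brank B \<Longrightarrow> smooth_fun_on (base B) (U \<inter> W) (c i)"
    "\<And>p. p \<in> U \<Longrightarrow> p \<in> W \<Longrightarrow> s p = (\<Sum>i<brank B. c i p *\<^sub>R e i p)"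
    using smooth_section_coeffs[OF assms(3) U] by blast
  obtain c' where c':
    "\<And>i. i < brank B \<Longrightarrow> smooth_fun_on (base B) (U \<inter> W) (c' i)"
    "\<And>p. p \<in> U \<Longrightarrow> p \<in> W \<Longrightarrow> s' p = (\<Sum>i<brank B. c' i p *\<^sub>R e i p)"
    using smooth_section_coeffs[OF assms(4) U] by blast
  show "\<exists>c. (\<forall>i<brank B. smooth_fun_on (base B) (U \<inter> W) (c i)) \<and>
      (\<forall>p\<in>U \<inter> W. s p + s' p = (\<Sum>i<brank B. c i p *\<^sub>R e i p))"
    using smooth_fun_on_add[OF base_manifold[OF B] UW] c c'
    by (intro exI[of _ "\<lambda>i p. c i p + c' i p"]) (simp add: scaleR_left_distrib sum.distrib)
qed

lemma smooth_section_on_mult: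
  assumes B: "vector_bundle B" and W: "openin (top_of (base B)) W"
    and g: "smooth_fun_on (base B) W g" and s: "smooth_section_on B W s"
  shows "smooth_section_on B W (\<lambda>p. g p *\<^sub>R s p)"
proof (rule smooth_section_onI)
  fix U e assume U: "(U, e) \<in> frames B"
  have UW: "openin (top_of (base B)) (U \<inter> W)"
    using frame_open[OF B U] W by auto
  obtain c where c:
    "\<And>i. i < brank B \<Longrightarrow> smooth_fun_on (base B) (U \<inter> W) (c i)"
    "\<And>p. p \<in> U \<Longrightarrow> p \<in> W \<Longrightarrow> s p = (\<Sum>i<brank B. c i p *\<^sub>R e i p)"
    using smooth_section_coeffs[OF s U] by blast
  show "\<exists>c. (\<forall>i<brank B. smooth_fun_on (base B) (U \<inter> W) (c i)) \<and>
      (\<forall>p\<in>U \<inter> W. g p *\<^sub>R s p = (\<Sum>i<brank B. c i p *\<^sub>R e i p))"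
    using smooth_fun_on_mult[OF base_manifold[OF B] UW] smooth_fun_on_subset[OF g, of "U \<inter> W"] c
    by (intro exI[of _ "\<lambda>i p. g p * c i p"]) (simp add: scaleR_sum_right)
qed

section \<open>Bundle maps and their action on smooth sections\<close>

lemma bundle_endo_linear:
  "bundle_endo B N \<Longrightarrow> p \<in> points (base B) \<Longrightarrow> u \<in> fibre B p \<Longrightarrow> w \<in> fibre B p \<Longrightarrow>
    N p (u + c *\<^sub>R w) = N p u + c *\<^sub>R N p w"
  by (simp add: bundle_endo_def)

lemma bundle_endo_zero:
  assumes "vector_bundle B" "bundle_endo B N" "p \<in> points (base B)"
  shows "N p 0 = 0"
  using bundle_endo_linear[OF assms(2,3), of 0 0 "-1"] fibre_subspace[OF assms(1,3)]
  by (simp add: subspace_0)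

lemma bundle_endo_scale:
  assumes "vector_bundle B" "bundle_endo B N" "p \<in> points (base B)" "u \<in> fibre B p"
  shows "N p (c *\<^sub>R u) = c *\<^sub>R N p u"
  using bundle_endo_linear[OF assms(2,3), of 0 u c] bundle_endo_zero[OF assms(1-3)]
    fibre_subspace[OF assms(1,3)] assms(4)
  by (simp add: subspace_0)

lemma bundle_endo_sum:
  assumes "vector_bundle B" "bundle_endo B N" "p \<in> points (base B)"
    and "\<And>i. i \<in> I \<Longrightarrow> v i \<in> fibre B p"
  shows "N p (\<Sum>i\<in>I. c i *\<^sub>R v i) = (\<Sum>i\<in>I. c i *\<^sub>R N p (v i))"
  using assms(4)
proof (induction I rule: infinite_finite_induct)
  case (insert x I)
  have "(\<Sum>i\<in>I. c i *\<^sub>R v i) \<in> fibre B p"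
    using insert.prems fibre_subspace[OF assms(1,3)] by (auto intro!: subspace_sum subspace_scale)
  with insert bundle_endo_linear[OF assms(2,3) this, of "v x" "c x"] show ?case
    by (simp add: add.commute)
qed (use bundle_endo_zero[OF assms(1-3)] in auto)

text \<open>In a frame, N is a matrix of smooth functions, so the coefficients of N s are the
  product of this matrix with the smooth coefficients of s.\<close>

lemma smooth_section_on_endo:
  assumes B: "vector_bundle B" and N: "bundle_endo B N" and W: "openin (top_of (base B)) W"
    and s: "smooth_section_on B W s"
  shows "smooth_section_on B W (\<lambda>p. N p (s p))"
proof (rule smooth_section_onI)
  fix U e assume U: "(U, e) \<in> frames B"
  have UW: "openin (top_of (base B)) (U \<inter> W)"
    using frame_open[OF B U] W by auto
  obtain c where c:
    "\<And>i. i<brank B \<Longrightarrow> smooth_fun_on (base B) (U \<inter> W) (c i)"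
    "\<And>p. p\<in>U \<inter> W \<Longrightarrow> s p = (\<Sum>i<brank B. c i p *\<^sub>R e i p)"
    using smooth_section_coeffs[OF s U] by (metis IntD1 IntD2)
  \<comment> \<open>\<open>m i j\<close> is the j-th coefficient of N applied to the i-th frame
    field.\<close>
  have "\<exists>m. \<forall>i\<in>{..<brank B}. (\<forall>j<brank B. smooth_fun_on (base B) U (m i j)) \<and>
      (\<forall>p\<in>U. N p (e i p) = (\<Sum>j<brank B. m i j p *\<^sub>R e j p))"
  proof (intro bchoice ballI)
    fix i assume "i \<in> {..<brank B}"
    then have "smooth_section_on B U (\<lambda>p. N p (e i p))"
      using N U unfolding bundle_endo_def by blast
    then show "\<exists>m. (\<forall>j<brank B. smooth_fun_on (base B) U (m j)) \<and>
      (\<forall>p\<in>U. N p (e i p) = (\<Sum>j<brank B. m j p *\<^sub>R e j p))"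
      by (rule smooth_section_coeffs[OF _ U]) (auto simp only: Int_absorb)
  qed
  then obtain m where m:
    "\<And>i j. i < brank B \<Longrightarrow> j < brank B \<Longrightarrow> smooth_fun_on (base B) U (m i j)"
    "\<And>i p. i < brank B \<Longrightarrow> p \<in> U \<Longrightarrow> N p (e i p) = (\<Sum>j<brank B. m i j p *\<^sub>R e j p)"
    by auto
  have "N p (s p) = (\<Sum>j<brank B. (\<Sum>i<brank B. c i p * m i j p) *\<^sub>R e j p)"
    if p: "p \<in> U \<inter> W" for p
  proof -
    have pp: "p \<in> points (base B)" using openin_subset[OF W] p by blast
    have "N p (s p) = (\<Sum>i<brank B. c i p *\<^sub>R N p (e i p))"
      unfolding c(2)[OF p] by (rule bundle_endo_sum[OF B N pp]) (use frame_in_fibre[OF B U] p in auto)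
    also have "\<dots> = (\<Sum>i<brank B. \<Sum>j<brank B. (c i p * m i j p) *\<^sub>R e j p)"
      using m(2) p by (intro sum.cong) (auto simp: scaleR_sum_right)
    also have "\<dots> = (\<Sum>j<brank B. (\<Sum>i<brank B. c i p * m i j p) *\<^sub>R e j p)"
      by (subst sum.swap) (simp add: scaleR_left.sum)
    finally show ?thesis .
  qed
  moreover have "smooth_fun_on (base B) (U \<inter> W) (\<lambda>p. \<Sum>i<brank B. c i p * m i j p)"
    if "j < brank B" for j
    using that c(1) smooth_fun_on_subset[OF m(1), of _ _ "U \<inter> W"]
    by (intro smooth_fun_on_sum smooth_fun_on_mult base_manifold[OF B] UW) simp_all
  ultimately show "\<exists>c. (\<forall>i<brank B. smooth_fun_on (base B) (U \<inter> W) (c i)) \<and>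
      (\<forall>p\<in>U \<inter> W. N p (s p) = (\<Sum>i<brank B. c i p *\<^sub>R e i p))"
    by (intro exI[of _ "\<lambda>j p. \<Sum>i<brank B. c i p * m i j p"]) auto
qed

text \<open>\<open>wedge_to_tangent\<close> grants smoothness only on tuples of frame fields. Mixed
  tuples, sections first and frame fields after them, make an induction possible: the last section
  is expanded in the frame, and each term moves one index from the sections to the frame
  fields.\<close>

lemma wedge_to_tangent_smooth_on_frame:
  assumes B: "vector_bundle B" and a: "wedge_to_tangent B k a"
    and W: "openin (top_of (base B)) W" and U: "(U, e) \<in> frames B"
    and f: "f \<in> smooth_funs (base B)"
  shows "\<lbrakk>\<forall>s\<in>set ss. smooth_section_on B W s; length ss + length is = k; set is \<subseteq> {..<brank B}\<rbrakk>
    \<Longrightarrow> smooth_fun_on (base B) (U \<inter> W) (\<lambda>p. a p (map (\<lambda>s. s p) ss @ map (\<lambda>i. e i p) is) f)"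
proof (induction ss arbitrary: "is" rule: rev_induct)
  case Nil
  then have "smooth_vfield_on (base B) U (\<lambda>p. a p (map (\<lambda>i. e i p) is))"
    using a U unfolding wedge_to_tangent_def tuples_def by auto
  then show ?case
    using f by (auto simp: smooth_vfield_on_def intro: smooth_fun_on_subset)
next
  case (snoc s ss)
  obtain c where c:
    "\<And>i. i<brank B \<Longrightarrow> smooth_fun_on (base B) (U \<inter> W) (c i)"
    "\<And>p. p\<in>U \<inter> W \<Longrightarrow> s p = (\<Sum>i<brank B. c i p *\<^sub>R e i p)"
    using smooth_section_coeffs[of B W s, OF _ U] snoc.prems(1) by (metis IntD1 IntD2 in_set_conv_decomp)
  have UW: "openin (top_of (base B)) (U \<inter> W)"
    using frame_open[OF B U] W by auto
  let ?L = "\<lambda>p i. map (\<lambda>s. s p) ss @ e i p # map (\<lambda>i. e i p) is"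
  have "a p (map (\<lambda>s. s p) (ss @ [s]) @ map (\<lambda>i. e i p) is) f = (\<Sum>i<brank B. c i p * a p (?L p i) f)"
    if p: "p \<in> U \<inter> W" for p
  proof -
    have pp: "p \<in> points (base B)" using openin_subset[OF W] p by blast
    let ?xs = "map (\<lambda>s. s p) ss @ s p # map (\<lambda>i. e i p) is"
    have sf: "s' p \<in> fibre B p" if "smooth_section_on B W s'" for s'
      using smooth_section_in_fibre[OF B that] p pp by auto
    have "?xs \<in> tuples k (fibre B p)"
      using snoc.prems sf frame_in_fibre[OF B U] p by (auto simp: tuples_def)
    \<comment> \<open>The section being expanded occupies slot \<open>length ss\<close>, so
      linearity in that slot is stated through a list update there.\<close>
    then have "a p (?xs[length ss := \<Sum>i<brank B. c i p *\<^sub>R e i p])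
        = (\<Sum>i<brank B. c i p *\<^sub>R a p (?xs[length ss := e i p]))"
      using a pp snoc.prems(2) frame_in_fibre[OF B U] p
      by (intro multilinear_sum[of k "fibre B p"] fibre_subspace[OF B])
        (auto simp: wedge_to_tangent_def)
    then show ?thesis
      using c(2)[OF p] by (simp add: list_update_append sum_fun_apply)
  qed
  note eq = this
  have "smooth_fun_on (base B) (U \<inter> W) (\<lambda>p. \<Sum>i<brank B. c i p * a p (?L p i) f)"
    using snoc.prems snoc.IH[of "_ # is"] c(1)
    by (intro smooth_fun_on_sum smooth_fun_on_mult base_manifold[OF B] UW) simp_all
  then show ?case
    by (rule smooth_fun_on_cong[OF base_manifold[OF B] UW]) (simp only: eq)
qed

text \<open>Near each point this is the preceding lemma with no frame fields left; smoothness is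
  then glued over the frame domains.\<close>

lemma wedge_to_tangent_smooth:
  assumes B: "vector_bundle B" and a: "wedge_to_tangent B k a"
    and W: "openin (top_of (base B)) W"
    and ss: "\<forall>s\<in>set ss. smooth_section_on B W s" "length ss = k"
  shows "smooth_vfield_on (base B) W (\<lambda>p. a p (map (\<lambda>s. s p) ss))"
  unfolding smooth_vfield_on_def
proof (intro conjI ballI)
  fix p assume p: "p \<in> W"
  then have pp: "p \<in> points (base B)" using openin_subset[OF W] by blast
  have "map (\<lambda>s. s p) ss \<in> tuples k (fibre B p)"
    using smooth_section_in_fibre[OF B _ p pp] ss by (auto simp: tuples_def)
  then show "a p (map (\<lambda>s. s p) ss) \<in> tangent_space (base B) p"
    using a pp by (auto simp: wedge_to_tangent_def)
next
  fix f assume f: "f \<in> smooth_funs (base B)"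
  show "smooth_fun_on (base B) W (\<lambda>p. a p (map (\<lambda>s. s p) ss) f)"
  proof (rule smooth_fun_on_local[OF base_manifold[OF B]])
    fix p assume p: "p \<in> W"
    then have pp: "p \<in> points (base B)" using openin_subset[OF W] by blast
    obtain U e where U: "(U, e) \<in> frames B" "p \<in> U"
      using frame_at[OF B pp] .
    show "\<exists>Q. p \<in> Q \<and> openin (top_of (base B)) Q \<and> Q \<subseteq> W \<and>
        smooth_fun_on (base B) Q (\<lambda>p. a p (map (\<lambda>s. s p) ss) f)"
      using wedge_to_tangent_smooth_on_frame[OF B a W U(1) f, of ss "[]"] ss p U
        frame_open[OF B U(1)] W
      by (intro exI[of _ "U \<inter> W"]) auto
  qed
qed

text \<open>Sections without any smoothness requirement: multiplying a section by the values of a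
  vector field on a function stays in this set for trivial reasons.\<close>

definition pre_sections :: "('m, 'v::real_vector) vbundle \<Rightarrow> ('m \<Rightarrow> 'v) set" where
  "pre_sections B =
    {s. (\<forall>p\<in>points (base B). s p \<in> fibre B p) \<and> (\<forall>p. p \<notin> points (base B) \<longrightarrow> s p = 0)}"

lemma sections_pre: "vector_bundle B \<Longrightarrow> s \<in> sections B \<Longrightarrow> s \<in> pre_sections B"
  using smooth_section_in_fibre[of B "points (base B)" s]
  by (simp add: sections_def pre_sections_def)

lemma pre_sections_subspace: "vector_bundle B \<Longrightarrow> subspace (pre_sections B)"
  using fibre_subspace[of B]
  by (auto simp: pre_sections_def subspace_def)

lemma fmult_pre: "vector_bundle B \<Longrightarrow> s \<in> pre_sections B \<Longrightarrow> fmult f s \<in> pre_sections B"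
  using fibre_subspace[of B] by (auto simp: pre_sections_def fmult_def subspace_scale)

lemma smooth_section_on_cong:
  assumes "smooth_section_on B W s" "\<And>p. p \<in> W \<Longrightarrow> s p = s' p"
  shows "smooth_section_on B W s'"
proof (rule smooth_section_onI)
  fix U e assume U: "(U, e) \<in> frames B"
  show "\<exists>c. (\<forall>i<brank B. smooth_fun_on (base B) (U \<inter> W) (c i)) \<and>
      (\<forall>p\<in>U \<inter> W. s' p = (\<Sum>i<brank B. c i p *\<^sub>R e i p))"
    using smooth_section_coeffs[OF assms(1) U] assms(2) by (metis IntD1 IntD2)
qed

lemma fmult_sections:
  "vector_bundle B \<Longrightarrow> f \<in> smooth_funs (base B) \<Longrightarrow> s \<in> sections B \<Longrightarrow> fmult f s \<in> sections B"
  using smooth_section_on_mult[of B "points (base B)" f s]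
  by (simp add: sections_def fmult_def smooth_funs_def)

lemma apply_endo_sections:
  assumes "vector_bundle B" "bundle_endo B N" "s \<in> sections B"
  shows "apply_endo B N s \<in> sections B"
proof -
  have "smooth_section_on B (points (base B)) (\<lambda>p. N p (s p))"
    using smooth_section_on_endo[OF assms(1,2) openin_topspace, of s] assms(3)
    by (simp add: sections_def)
  then have "smooth_section_on B (points (base B)) (apply_endo B N s)"
    by (rule smooth_section_on_cong) (simp add: apply_endo_def)
  then show ?thesis
    by (simp add: sections_def) (simp add: apply_endo_def)
qed

lemma apply_endo_linear:
  "bundle_endo B N \<Longrightarrow> x \<in> pre_sections B \<Longrightarrow> y \<in> pre_sections B \<Longrightarrow>
    apply_endo B N (x + c *\<^sub>R y) = apply_endo B N x + c *\<^sub>R apply_endo B N y"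
  by (auto simp: pre_sections_def apply_endo_def fun_eq_iff bundle_endo_linear)

lemma apply_endo_fmult:
  "vector_bundle B \<Longrightarrow> bundle_endo B N \<Longrightarrow> x \<in> pre_sections B \<Longrightarrow>
    apply_endo B N (fmult f x) = fmult f (apply_endo B N x)"
  by (auto simp: pre_sections_def apply_endo_def fun_eq_iff fmult_def bundle_endo_scale)

section \<open>The bundle map Id + tN\<close>

lemma id_plus_endo:
  assumes B: "vector_bundle B" and N: "bundle_endo B N"
  shows "bundle_endo B (id_plus t N)"
  unfolding bundle_endo_def
proof (intro conjI ballI allI, goal_cases)
  case (1 p u)
  then have "N p u \<in> fibre B p"
    using N unfolding bundle_endo_def by blast
  with 1 show ?case
    unfolding id_plus_def
    using subspace_add[OF fibre_subspace[OF B]] subspace_scale[OF fibre_subspace[OF B]] by blast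
next
  case (2 p u w c)
  then show ?case
    by (simp add: id_plus_def bundle_endo_linear[OF N] algebra_simps)
next
  case (3 Ue)
  obtain U e where Ue: "Ue = (U, e)" by fastforce
  have U: "(U, e) \<in> frames B"
    using 3 Ue by simp
  have "smooth_section_on B U (\<lambda>p. e i p + t *\<^sub>R N p (e i p))" if i: "i < brank B" for i
  proof -
    have "smooth_section_on B U (\<lambda>p. N p (e i p))"
      using N i U unfolding bundle_endo_def by blast
    note smooth_section_on_mult[OF B frame_open[OF B U] smooth_fun_on_const[of _ _ t] this]
    from smooth_section_on_add[OF B frame_open[OF B U] frame_smooth[OF B U i] this]
    show ?thesis .
  qed
  then show ?case by (simp add: Ue id_plus_def)
qed

lemma apply_id_plus:
  "s \<in> pre_sections B \<Longrightarrow> apply_endo B (id_plus t N) s = s + t *\<^sub>R apply_endo B N s"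
  by (auto simp: apply_endo_def id_plus_def pre_sections_def fun_eq_iff)


section \<open>Polynomials with vector coefficients\<close>

text \<open>The coefficient space carries no topology, so the argument is algebraic: P(2t) - 2^(m+1)
  P(t) has no term of degree m+1, and its lower coefficients are nonzero multiples of those of P, so
  the induction hypothesis kills them.\<close>

lemma polynomial_coeffs_zero:
  fixes c :: "nat \<Rightarrow> 'w::real_vector"
  assumes "\<And>t::real. (\<Sum>k\<le>m. t ^ k *\<^sub>R c k) = 0" "k \<le> m"
  shows "c k = 0"
  using assms
proof (induction m arbitrary: c k)
  case 0
  then show ?case using "0.prems"(1)[of 0] by simp
next
  case (Suc m)
  have "(\<Sum>k\<le>m. t ^ k *\<^sub>R ((2 ^ k - 2 ^ Suc m) *\<^sub>R c k)) = 0" for t :: real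
  proof -
    have "(\<Sum>k\<le>m. t ^ k *\<^sub>R ((2 ^ k - 2 ^ Suc m) *\<^sub>R c k)) =
        (\<Sum>k\<le>Suc m. t ^ k *\<^sub>R ((2 ^ k - 2 ^ Suc m) *\<^sub>R c k))"
      by simp
    also have "\<dots> = (\<Sum>k\<le>Suc m. (2 * t) ^ k *\<^sub>R c k - 2 ^ Suc m *\<^sub>R (t ^ k *\<^sub>R c k))"
      by (intro sum.cong refl)
        (simp add: power_mult_distrib scaleR_left_diff_distrib algebra_simps del: power_Suc)
    also have "\<dots> = (\<Sum>k\<le>Suc m. (2 * t) ^ k *\<^sub>R c k) -
        2 ^ Suc m *\<^sub>R (\<Sum>k\<le>Suc m. t ^ k *\<^sub>R c k)"
      by (simp only: sum_subtractf scaleR_sum_right)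
    also have "\<dots> = 0"
      by (simp only: Suc.prems(1)) simp
    finally show ?thesis .
  qed
  note IH = Suc.IH[OF this]
  have z: "c k = 0" if "k \<le> m" for k
  proof -
    have "(2::real) ^ k < 2 ^ Suc m"
      using that by (intro power_strict_increasing) auto
    then show ?thesis
      using IH[OF that] by simp
  qed
  then have "c (Suc m) = 0"
    using Suc.prems(1)[of 1] by simp
  then show ?case
    using z Suc.prems(2) le_Suc_eq by metis
qed

lemma polynomial_coeffs_eq:
  fixes c d :: "nat \<Rightarrow> 'w::real_vector"
  assumes "\<And>t::real. (\<Sum>k\<le>m. t ^ k *\<^sub>R c k) = (\<Sum>k\<le>m. t ^ k *\<^sub>R d k)" "k \<le> m"
  shows "c k = d k"
proof -
  have "c k - d k = 0"
    by (rule polynomial_coeffs_zero[where m = m and c = "\<lambda>k. c k - d k"])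
      (use assms in \<open>auto simp: scaleR_right_diff_distrib sum_subtractf\<close>)
  then show ?thesis by simp
qed

text \<open>Multiplication by t shifts indices by one. The conditionals guard both ends:
  \<open>c\<close> may be nonzero beyond \<open>m\<close>, and truncated subtraction would turn
  \<open>d (0 - 1)\<close> into \<open>d 0\<close>.\<close>

lemma polynomial_shift:
  fixes c d :: "nat \<Rightarrow> 'w::real_vector" and t :: real
  shows "(\<Sum>k\<le>m. t ^ k *\<^sub>R c k) + t *\<^sub>R (\<Sum>k\<le>m. t ^ k *\<^sub>R d k) =
    (\<Sum>k\<le>Suc m. t ^ k *\<^sub>R ((if k \<le> m then c k else 0) + (if k = 0 then 0 else d (k - 1))))"
proof -
  have 1: "(\<Sum>k\<le>Suc m. t ^ k *\<^sub>R (if k \<le> m then c k else 0)) = (\<Sum>k\<le>m. t ^ k *\<^sub>R c k)"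
    by simp
  have 2: "(\<Sum>k\<le>Suc m. t ^ k *\<^sub>R (if k = 0 then 0 else d (k - 1))) = t *\<^sub>R (\<Sum>k\<le>m. t ^ k *\<^sub>R d k)"
    by (simp add: sum.atMost_Suc_shift scaleR_sum_right del: sum.atMost_Suc)
  show ?thesis
    by (simp only: scaleR_right_distrib sum.distrib 1 2)
qed

text \<open>Linearity relative to a subspace, because \<open>apply_endo\<close> is only known to be
  linear on fields with values in the fibres.\<close>

definition linear_map_on :: "'w::real_vector set \<Rightarrow> ('w \<Rightarrow> 'u::real_vector) \<Rightarrow> bool" where
  "linear_map_on S T \<longleftrightarrow> subspace S \<and>
    (\<forall>x\<in>S. \<forall>y\<in>S. \<forall>c. T (x + c *\<^sub>R y) = T x + c *\<^sub>R T y)"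

lemma linear_map_on_zero: "linear_map_on S T \<Longrightarrow> T 0 = 0"
proof -
  assume T: "linear_map_on S T"
  then have "T (0 + (-1) *\<^sub>R 0) = T 0 + (-1) *\<^sub>R T 0"
    using subspace_0 unfolding linear_map_on_def by blast
  then show ?thesis by simp
qed

lemma linear_map_on_sum:
  assumes T: "linear_map_on S T" and "\<And>i. i \<in> I \<Longrightarrow> v i \<in> S"
  shows "T (\<Sum>i\<in>I. c i *\<^sub>R v i) = (\<Sum>i\<in>I. c i *\<^sub>R T (v i))"
  using assms(2)
proof (induction I rule: infinite_finite_induct)
  case (insert x I)
  have S: "subspace S" using T by (simp add: linear_map_on_def)
  have "(\<Sum>i\<in>I. c i *\<^sub>R v i) \<in> S"
    using insert.prems by (intro subspace_sum[OF S] subspace_scale[OF S]) auto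
  then have "T ((\<Sum>i\<in>I. c i *\<^sub>R v i) + c x *\<^sub>R v x) = T (\<Sum>i\<in>I. c i *\<^sub>R v i) + c x *\<^sub>R T (v x)"
    using T insert.prems unfolding linear_map_on_def by blast
  with insert show ?case by (simp add: add.commute)
qed (use linear_map_on_zero[OF T] in auto)

lemma linear_map_on_diff:
  "linear_map_on S T \<Longrightarrow> x \<in> S \<Longrightarrow> y \<in> S \<Longrightarrow> T (x - y) = T x - T y"
proof -
  assume "linear_map_on S T" "x \<in> S" "y \<in> S"
  then have "T (x + (-1) *\<^sub>R y) = T x + (-1) *\<^sub>R T y"
    unfolding linear_map_on_def by blast
  then show ?thesis by simp
qed

text \<open>\<open>Id + t T\<close> need not be injective for any given \<open>t \<noteq> 0\<close>, but it is injective on polynomials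
  in \<open>t\<close>, because it preserves the coefficient of lowest degree.\<close>

lemma polynomial_cancel:
  assumes T: "linear_map_on S T" and c: "\<And>k. k \<le> m \<Longrightarrow> c k \<in> S"
    and P: "\<And>t. P t = (\<Sum>k\<le>m. t ^ k *\<^sub>R c k)"
    and z: "\<And>t::real. P t + t *\<^sub>R T (P t) = 0" and "k \<le> m"
  shows "c k = 0"
proof -
  have "(\<Sum>k\<le>Suc m. t ^ k *\<^sub>R ((if k \<le> m then c k else 0) + (if k = 0 then 0 else T (c (k - 1))))) = 0"
    for t
  proof -
    have "T (P t) = (\<Sum>k\<le>m. t ^ k *\<^sub>R T (c k))"
      unfolding P using c by (intro linear_map_on_sum[OF T]) simp
    then show ?thesis
      using z[of t] polynomial_shift[where m = m and t = t and c = c and d = "\<lambda>k. T (c k)"] P by simp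
  qed
  note * = polynomial_coeffs_zero[OF this]
  \<comment> \<open>The coefficient of t^k is c_k + T c_(k-1); once c_(k-1) = 0 it is c_k
    itself.\<close>
  show ?thesis
    using \<open>k \<le> m\<close>
  proof (induction k)
    case 0
    then show ?case using *[of 0] by simp
  next
    case (Suc k)
    then show ?case using *[of "Suc k"] linear_map_on_zero[OF T] by simp
  qed
qed

lemma polynomial_cancel_eq:
  assumes T: "linear_map_on S T"
    and c: "\<And>k. k \<le> m \<Longrightarrow> c k \<in> S" and d: "\<And>k. k \<le> m \<Longrightarrow> d k \<in> S"
    and eq: "\<And>t::real. (\<Sum>k\<le>m. t ^ k *\<^sub>R c k) + t *\<^sub>R T (\<Sum>k\<le>m. t ^ k *\<^sub>R c k) =
      (\<Sum>k\<le>m. t ^ k *\<^sub>R d k) + t *\<^sub>R T (\<Sum>k\<le>m. t ^ k *\<^sub>R d k)"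
    and "k \<le> m"
  shows "c k = d k"
proof -
  have S: "subspace S" using T by (simp add: linear_map_on_def)
  let ?C = "\<lambda>t::real. \<Sum>k\<le>m. t ^ k *\<^sub>R c k" and ?D = "\<lambda>t::real. \<Sum>k\<le>m. t ^ k *\<^sub>R d k"
  have CD: "?C t \<in> S" "?D t \<in> S" for t
    using c d by (auto intro!: subspace_sum[OF S] subspace_scale[OF S])
  have "c k - d k = 0"
  proof (rule polynomial_cancel[OF T, where m = m and P = "\<lambda>t. ?C t - ?D t" and c = "\<lambda>k. c k - d k"])
    show "?C t - ?D t = (\<Sum>k\<le>m. t ^ k *\<^sub>R (c k - d k))" for t
      by (simp add: scaleR_right_diff_distrib sum_subtractf)
    show "?C t - ?D t + t *\<^sub>R T (?C t - ?D t) = 0" for t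
      using eq[of t] unfolding linear_map_on_diff[OF T CD, of t t] scaleR_right_diff_distrib
      by (simp add: algebra_simps)
  qed (use c d subspace_diff[OF S] \<open>k \<le> m\<close> in auto)
  then show ?thesis by simp
qed

text \<open>The degree is left existential so that nested brackets can be treated without writing
  out their coefficients. The coefficients vanish past \<open>m\<close> so that several paths can be
  brought to a common degree.\<close>

definition polynomial_path :: "'w::real_vector set \<Rightarrow> (real \<Rightarrow> 'w) \<Rightarrow> bool" where
  "polynomial_path S P \<longleftrightarrow>
    (\<exists>m c. (\<forall>k. c k \<in> S) \<and> (\<forall>k>m. c k = 0) \<and> (\<forall>t. P t = (\<Sum>k\<le>m. t ^ k *\<^sub>R c k)))"

lemma polynomial_pathE:
  assumes "polynomial_path S P"
  obtains m c where "\<And>k. c k \<in> S" "\<And>t M. m \<le> M \<Longrightarrow> P t = (\<Sum>k\<le>M. t ^ k *\<^sub>R c k)"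
proof -
  obtain m c where c: "\<forall>k. c k \<in> S" "\<forall>k>m. c k = 0" "\<forall>t. P t = (\<Sum>k\<le>m. t ^ k *\<^sub>R c k)"
    using assms unfolding polynomial_path_def by blast
  have "P t = (\<Sum>k\<le>M. t ^ k *\<^sub>R c k)" if "m \<le> M" for t M
  proof -
    have "(\<Sum>k\<le>m. t ^ k *\<^sub>R c k) = (\<Sum>k\<le>M. t ^ k *\<^sub>R c k)"
      by (rule sum.mono_neutral_left) (use c(2) that in auto)
    with c(3) show ?thesis by simp
  qed
  with c(1) show ?thesis by (intro that[of c m]) auto
qed

lemma polynomial_pathI:
  assumes "subspace S" "\<And>k. k \<le> m \<Longrightarrow> c k \<in> S" "\<And>t. P t = (\<Sum>k\<le>m. t ^ k *\<^sub>R c k)"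
  shows "polynomial_path S P"
  unfolding polynomial_path_def
  by (rule exI[of _ m], rule exI[of _ "\<lambda>k. if k \<le> m then c k else 0"])
    (use assms subspace_0 in auto)

lemma polynomial_path_const: "subspace S \<Longrightarrow> v \<in> S \<Longrightarrow> polynomial_path S (\<lambda>t. v)"
  by (rule polynomial_pathI[of S 0 "\<lambda>_. v"]) auto

lemma polynomial_path_add_scale:
  assumes S: "subspace S" and "polynomial_path S P" "polynomial_path S Q"
  shows "polynomial_path S (\<lambda>t. P t + r *\<^sub>R Q t)"
proof -
  obtain m c where c: "\<And>k. c k \<in> S" "\<And>t M. m \<le> M \<Longrightarrow> P t = (\<Sum>k\<le>M. t ^ k *\<^sub>R c k)"
    by (rule polynomial_pathE[OF assms(2)]) blast
  obtain m' d where d: "\<And>k. d k \<in> S" "\<And>t M. m' \<le> M \<Longrightarrow> Q t = (\<Sum>k\<le>M. t ^ k *\<^sub>R d k)"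
    by (rule polynomial_pathE[OF assms(3)]) blast
  show ?thesis
  proof (rule polynomial_pathI[OF S])
    show "c k + r *\<^sub>R d k \<in> S" for k
      using c(1) d(1) by (intro subspace_add[OF S] subspace_scale[OF S])
    show "P t + r *\<^sub>R Q t = (\<Sum>k\<le>max m m'. t ^ k *\<^sub>R (c k + r *\<^sub>R d k))" for t
      using c(2)[of "max m m'" t] d(2)[of "max m m'" t]
      by (simp add: scaleR_right_distrib sum.distrib scaleR_sum_right mult.commute)
  qed
qed

lemma polynomial_path_sum:
  assumes S: "subspace S" and "\<And>i. i \<in> I \<Longrightarrow> polynomial_path S (P i)"
  shows "polynomial_path S (\<lambda>t. \<Sum>i\<in>I. P i t)"
  using assms(2)
proof (induction I rule: infinite_finite_induct)
  case (insert x I)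
  then show ?case
    using polynomial_path_add_scale[OF S, of "P x" "\<lambda>t. \<Sum>i\<in>I. P i t" 1] by simp
qed (use polynomial_path_const[OF S subspace_0[OF S]] in auto)

lemma polynomial_path_times_power:
  assumes S: "subspace S" and P: "polynomial_path S P"
  shows "polynomial_path S (\<lambda>t. t ^ j *\<^sub>R P t)"
proof (induction j)
  case 0
  then show ?case using P by simp
next
  case (Suc j)
  obtain m c where c: "\<And>k. c k \<in> S" "\<And>t M. m \<le> M \<Longrightarrow> t ^ j *\<^sub>R P t = (\<Sum>k\<le>M. t ^ k *\<^sub>R c k)"
    by (rule polynomial_pathE[OF Suc]) blast
  show ?case
  proof (rule polynomial_pathI[OF S])
    show "(if k = 0 then 0 else c (k - 1)) \<in> S" for k
      using c(1) subspace_0[OF S] by simp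
    show "t ^ Suc j *\<^sub>R P t = (\<Sum>k\<le>Suc m. t ^ k *\<^sub>R (if k = 0 then 0 else c (k - 1)))" for t
      using c(2)[of m t] polynomial_shift[where m = m and t = t and c = "\<lambda>_. 0" and d = c]
      by (simp del: sum.atMost_Suc flip: scaleR_scaleR)
  qed
qed

lemma polynomial_path_cancel:
  assumes T: "linear_map_on S T" and P: "polynomial_path S P"
    and z: "\<And>t. P t + t *\<^sub>R T (P t) = 0"
  shows "P t = 0"
proof -
  obtain m c where c: "\<And>k. c k \<in> S" "\<And>t M. m \<le> M \<Longrightarrow> P t = (\<Sum>k\<le>M. t ^ k *\<^sub>R c k)"
    by (rule polynomial_pathE[OF P]) blast
  have "c k = 0" if "k \<le> m" for k
    using polynomial_cancel[OF T c(1) c(2)[OF order_refl] z that] .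
  then show ?thesis using c(2)[of m t] by simp
qed

text \<open>The slots are expanded one at a time; each splits every term in two, and I records the
  slots in which T was chosen.\<close>

lemma multilinear_expand:
  fixes F :: "'a::real_vector list \<Rightarrow> 'b::real_vector"
  assumes F: "multilinear k V F" and V: "subspace V" and T: "\<And>x. x \<in> V \<Longrightarrow> T x \<in> V"
    and xs: "xs \<in> tuples k V"
  shows "F (map (\<lambda>x. x + t *\<^sub>R T x) xs) =
    (\<Sum>I\<in>Pow {..<k}. t ^ card I *\<^sub>R F (map (\<lambda>i. if i \<in> I then T (xs ! i) else xs ! i) [0..<k]))"
proof -
  \<comment> \<open>\<open>L j\<close> has the first \<open>j\<close> slots already of the form x +
    t T x; \<open>R I\<close> has T applied in the slots of I.\<close>
  define L where "L j xs = map (\<lambda>i. if i < j then xs ! i + t *\<^sub>R T (xs ! i) else xs ! i) [0..<k]"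
    for j and xs :: "'a list"
  define R where "R I xs = map (\<lambda>i. if i \<in> I then T (xs ! i) else xs ! i) [0..<k]"
    for I and xs :: "'a list"
  have main: "F (L j xs) = (\<Sum>I\<in>Pow {..<j}. t ^ card I *\<^sub>R F (R I xs))"
    if "j \<le> k" "xs \<in> tuples k V" for j xs
    using that
  proof (induction j arbitrary: xs)
    case 0
    have "L 0 xs = R {} xs" by (simp add: L_def R_def)
    then show ?case by simp
  next
    case (Suc j)
    have len: "length xs = k" using Suc.prems by (simp add: tuples_def)
    have xj: "xs ! j \<in> V" using Suc.prems by (auto intro: tuples_nth)
    have Lj: "L j xs \<in> tuples k V"
      using Suc.prems(2) V T
      by (auto simp: L_def tuples_def subset_iff intro!: subspace_add subspace_scale)
    have up: "xs[j := T (xs ! j)] \<in> tuples k V"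
      using Suc.prems(2) T[OF xj] by auto
    \<comment> \<open>\<open>L j\<close> leaves slot \<open>j\<close> alone, so T can be put there
      before or after it. The induction hypothesis is therefore needed for a modified tuple, which
      is why \<open>xs\<close> is arbitrary.\<close>
    have e1: "L (Suc j) xs = (L j xs)[j := xs ! j + t *\<^sub>R T (xs ! j)]"
      and e2: "(L j xs)[j := xs ! j] = L j xs"
      and e3: "(L j xs)[j := T (xs ! j)] = L j (xs[j := T (xs ! j)])"
      using Suc.prems(1) len
      by (auto simp: L_def nth_list_update intro!: nth_equalityI)
    have e4: "R I (xs[j := T (xs ! j)]) = R (insert j I) xs" if "I \<in> Pow {..<j}" for I
      using Suc.prems(1) len that by (auto simp: R_def nth_list_update)
    have inj: "inj_on (insert j) (Pow {..<j})"
      by (rule inj_onI) (metis PowD insert_ident lessThan_iff less_irrefl subsetD)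
    have "F (L (Suc j) xs) = F (L j xs) + t *\<^sub>R F (L j (xs[j := T (xs ! j)]))"
      unfolding e1 using multilinearD[OF F Lj, of j "xs ! j" "T (xs ! j)" t] Suc.prems(1) xj T[OF xj]
      by (simp add: e2 e3)
    also have "\<dots> = (\<Sum>I\<in>Pow {..<j}. t ^ card I *\<^sub>R F (R I xs)) +
        (\<Sum>I\<in>Pow {..<j}. t *\<^sub>R t ^ card I *\<^sub>R F (R (insert j I) xs))"
      using Suc.IH[of xs] Suc.IH[OF _ up] Suc.prems by (simp add: scaleR_sum_right e4)
    \<comment> \<open>The subsets of \<open>{..<Suc j}\<close> containing \<open>j\<close> are the
      sets \<open>insert j I\<close>; the additional element accounts for the additional factor
      t.\<close>
    also have "(\<Sum>I\<in>Pow {..<j}. t *\<^sub>R t ^ card I *\<^sub>R F (R (insert j I) xs)) =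
        (\<Sum>I\<in>insert j ` Pow {..<j}. t ^ card I *\<^sub>R F (R I xs))"
    proof (subst sum.reindex[OF inj], rule sum.cong[OF refl])
      fix I assume "I \<in> Pow {..<j}"
      then have "finite I" "j \<notin> I" by (auto intro: finite_subset)
      then show "t *\<^sub>R t ^ card I *\<^sub>R F (R (insert j I) xs) =
          ((\<lambda>I. t ^ card I *\<^sub>R F (R I xs)) \<circ> insert j) I"
        by simp
    qed
    also have "(\<Sum>I\<in>Pow {..<j}. t ^ card I *\<^sub>R F (R I xs)) + \<dots> =
        (\<Sum>I\<in>Pow {..<Suc j}. t ^ card I *\<^sub>R F (R I xs))"
      unfolding lessThan_Suc Pow_insert by (rule sum.union_disjoint[symmetric]) auto
    finally show ?case .
  qed
  moreover have "L k xs = map (\<lambda>x. x + t *\<^sub>R T x) xs"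
    using xs by (auto simp: L_def tuples_def intro!: nth_equalityI)
  ultimately show ?thesis
    using main[OF order_refl xs] by (simp add: R_def)
qed


section \<open>Deformations along a bundle map\<close>

text \<open>The coefficient of t^j in F evaluated on the sections x_i + t N x_i. F is generic so
  that the bracket and the anchor share one expansion.\<close>

definition insert_sum ::
    "('m, 'v::real_vector) vbundle \<Rightarrow> ('m \<Rightarrow> 'v \<Rightarrow> 'v) \<Rightarrow> nat \<Rightarrow>
     (('m \<Rightarrow> 'v) list \<Rightarrow> 'b::real_vector) \<Rightarrow> nat \<Rightarrow> ('m \<Rightarrow> 'v) list \<Rightarrow> 'b" where
  "insert_sum B N k F j xs = (\<Sum>I\<in>{I. I \<subseteq> {..<k} \<and> card I = j}. F (insert_endo B N I xs))"

lemma insert_sum_0: "insert_sum B N k F 0 xs = F xs"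
proof -
  have "{I. I \<subseteq> {..<k} \<and> card I = 0} = {{}}"
    by (auto dest: finite_subset)
  then show ?thesis by (simp add: insert_sum_def insert_endo_def map_nth)
qed

lemma insert_sum_full:
  assumes "length xs = k"
  shows "insert_sum B N k F k xs = F (map (apply_endo B N) xs)"
proof -
  have "{I. I \<subseteq> {..<k} \<and> card I = k} = {{..<k}}"
    using card_subset_eq[of "{..<k}"] by auto
  moreover have "insert_endo B N {..<k} xs = map (apply_endo B N) xs"
    using assms by (auto simp: insert_endo_def intro!: nth_equalityI)
  ultimately show ?thesis by (simp add: insert_sum_def)
qed

lemma insert_endo_tuples:
  assumes B: "vector_bundle B" and N: "bundle_endo B N" and xs: "xs \<in> tuples k (sections B)"
  shows "insert_endo B N I xs \<in> tuples k (sections B)"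
proof -
  have "length xs = k" "\<And>i. i < k \<Longrightarrow> xs ! i \<in> sections B"
    using xs by (auto simp: tuples_def)
  then show ?thesis
    using apply_endo_sections[OF B N] by (auto simp: insert_endo_def tuples_def)
qed

lemma multilinear_id_plus:
  assumes B: "vector_bundle B" and N: "bundle_endo B N" and S: "subspace (sections B)"
    and F: "multilinear k (sections B) F" and xs: "xs \<in> tuples k (sections B)"
  shows "F (map (apply_endo B (id_plus t N)) xs) =
    (\<Sum>j\<le>k. t ^ j *\<^sub>R insert_sum B N k F j xs)"
proof -
  have eq: "map (apply_endo B (id_plus t N)) xs = map (\<lambda>x. x + t *\<^sub>R apply_endo B N x) xs"
    using xs sections_pre[OF B] by (auto simp: tuples_def apply_id_plus)
  have "F (map (apply_endo B (id_plus t N)) xs) =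
      (\<Sum>I\<in>Pow {..<k}. t ^ card I *\<^sub>R F (insert_endo B N I xs))"
    unfolding eq using multilinear_expand[where T = "apply_endo B N", OF F S apply_endo_sections[OF B N] xs] xs
    by (simp add: insert_endo_def tuples_def)
  \<comment> \<open>Sort the subsets by size: the size is the exponent of t.\<close>
  also have "\<dots> = (\<Sum>j\<le>k. \<Sum>I\<in>{I\<in>Pow {..<k}. card I = j}. t ^ card I *\<^sub>R F (insert_endo B N I xs))"
    by (rule sum.group[symmetric]) (auto dest: subset_eq_atLeast0_lessThan_card card_mono[rotated])
  also have "\<dots> = (\<Sum>j\<le>k. t ^ j *\<^sub>R insert_sum B N k F j xs)"
    by (auto simp: insert_sum_def scaleR_sum_right intro!: sum.cong)
  finally show ?thesis .
qed

section \<open>Vector fields, and anchors acting on sections\<close>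

lemma vector_fields_add:
  assumes M: "smooth_manifold M" and "X \<in> vector_fields M" "Y \<in> vector_fields M"
  shows "X + Y \<in> vector_fields M"
proof -
  have "smooth_fun_on M (points M) (\<lambda>p. (X + Y) p f)" if "f \<in> smooth_funs M" for f
    using smooth_fun_on_add[OF M openin_topspace, of "\<lambda>p. X p f" "\<lambda>p. Y p f"] that assms(2,3)
    by (simp add: vector_fields_def smooth_vfield_on_def)
  moreover have "(X + Y) p \<in> tangent_space M p" if "p \<in> points M" for p
    using that assms(2,3)
    by (simp add: vector_fields_def smooth_vfield_on_def tangent_space_def algebra_simps)
  ultimately show ?thesis
    using assms(2,3) by (simp add: vector_fields_def smooth_vfield_on_def)
qed

lemma vector_fields_zero: "0 \<in> vector_fields M"
  by (simp add: vector_fields_def smooth_vfield_on_def tangent_space_def smooth_fun_on_const)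

lemma vector_fields_sum:
  assumes "smooth_manifold M" "\<And>i. i \<in> I \<Longrightarrow> X i \<in> vector_fields M"
  shows "(\<Sum>i\<in>I. X i) \<in> vector_fields M"
  using assms(2)
  by (induction I rule: infinite_finite_induct)
    (simp_all add: vector_fields_add[OF assms(1)] vector_fields_zero)

lemma apply_anchor_vector_field:
  assumes B: "vector_bundle B" and a: "wedge_to_tangent B k a" and xs: "xs \<in> tuples k (sections B)"
  shows "apply_anchor B a xs \<in> vector_fields (base B)"
proof -
  have "smooth_vfield_on (base B) (points (base B)) (\<lambda>p. a p (map (\<lambda>s. s p) xs))"
    using xs by (intro wedge_to_tangent_smooth[OF B a]) (auto simp: tuples_def sections_def)
  moreover have "smooth_fun_on (base B) (points (base B)) (\<lambda>p. apply_anchor B a xs p f)"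
    if "smooth_fun_on (base B) (points (base B)) (\<lambda>p. a p (map (\<lambda>s. s p) xs) f)" for f
    by (rule smooth_fun_on_cong[OF base_manifold[OF B] _ that]) (simp_all add: apply_anchor_def)
  ultimately have "smooth_vfield_on (base B) (points (base B)) (apply_anchor B a xs)"
    by (simp add: smooth_vfield_on_def) (simp add: apply_anchor_def)
  then show ?thesis
    by (simp add: vector_fields_def) (simp add: apply_anchor_def)
qed

lemma tuples_at: "vector_bundle B \<Longrightarrow> xs \<in> tuples k (sections B) \<Longrightarrow> p \<in> points (base B) \<Longrightarrow>
    map (\<lambda>s. s p) xs \<in> tuples k (fibre B p)"
  using sections_pre[of B] by (auto simp: pre_sections_def intro: tuples_map)

lemma section_at: "vector_bundle B \<Longrightarrow> x \<in> sections B \<Longrightarrow> p \<in> points (base B) \<Longrightarrow> x p \<in> fibre B p"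
  using sections_pre[of B] by (auto simp: pre_sections_def)

text \<open>At each point p this is fibrewise multilinearity with the scalar \<open>f p\<close>.
  Constant f gives multilinearity over the reals.\<close>

lemma apply_anchor_linear:
  assumes B: "vector_bundle B" and a: "wedge_to_tangent B k a" and xs: "xs \<in> tuples k (sections B)"
    and i: "i < k" and y: "y \<in> sections B" and z: "z \<in> sections B"
  shows "apply_anchor B a (xs[i := y + fmult f z]) =
    apply_anchor B a (xs[i := y]) + fmult f (apply_anchor B a (xs[i := z]))"
proof (rule ext)
  fix p
  show "apply_anchor B a (xs[i := y + fmult f z]) p =
    (apply_anchor B a (xs[i := y]) + fmult f (apply_anchor B a (xs[i := z]))) p"
  proof (cases "p \<in> points (base B)")
    case True
    then have "multilinear k (fibre B p) (a p)"
      using a by (simp add: wedge_to_tangent_def)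
    from multilinearD[OF this tuples_at[OF B xs True] i section_at[OF B y True]
        section_at[OF B z True], of "f p"] True
    show ?thesis by (simp add: apply_anchor_def map_update fmult_def)
  qed (simp add: apply_anchor_def fmult_def)
qed

lemma fmult_const: "fmult (\<lambda>_. c) z = c *\<^sub>R z"
  by (simp add: fmult_def fun_eq_iff)

lemma apply_anchor_multilinear:
  assumes "vector_bundle B" "wedge_to_tangent B k a"
  shows "multilinear k (sections B) (apply_anchor B a)"
  using apply_anchor_linear[OF assms, where f = "\<lambda>_. c" for c]
  by (simp add: multilinear_def fmult_const)

lemma apply_anchor_skew:
  assumes B: "vector_bundle B" and a: "wedge_to_tangent B k a"
  shows "skew k (sections B) (apply_anchor B a)"
  unfolding skew_def
proof (intro ballI allI impI, rule ext)
  fix xs i j p assume xs: "xs \<in> tuples k (sections B)" and ij: "i < j \<and> j < k"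
  show "apply_anchor B a (xs[i := xs ! j, j := xs ! i]) p = (- apply_anchor B a xs) p"
  proof (cases "p \<in> points (base B)")
    case True
    then have "skew k (fibre B p) (a p)"
      using a by (simp add: wedge_to_tangent_def)
    from skewD[OF this tuples_at[OF B xs True], of i j] True ij xs
    show ?thesis by (simp add: apply_anchor_def map_update tuples_def)
  qed (simp add: apply_anchor_def)
qed

text \<open>Algebraic properties pass through P fibrewise. For smoothness, P sends frame fields to
  smooth sections, on which \<open>a\<close> is smooth by
  \<open>wedge_to_tangent_smooth\<close>.\<close>

lemma wedge_to_tangent_endo:
  assumes B: "vector_bundle B" and a: "wedge_to_tangent B k a" and P: "bundle_endo B P"
  shows "wedge_to_tangent B k (\<lambda>p vs. a p (map (P p) vs))"
  unfolding wedge_to_tangent_def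
proof (intro conjI ballI, goal_cases)
  case (1 p vs)
  then have "map (P p) vs \<in> tuples k (fibre B p)"
    using P by (auto simp: bundle_endo_def intro: tuples_map)
  then show ?case using a 1 by (auto simp: wedge_to_tangent_def)
next
  case (2 p)
  have Pp: "P p u \<in> fibre B p" if "u \<in> fibre B p" for u
    using P 2 that by (auto simp: bundle_endo_def)
  have map_P: "map (P p) vs \<in> tuples k (fibre B p)" if "vs \<in> tuples k (fibre B p)" for vs
    using that Pp by (rule tuples_map)
  have "multilinear k (fibre B p) (a p)"
    using a 2 by (simp add: wedge_to_tangent_def)
  note multilinearD[OF this map_P _ Pp Pp]
  then show ?case
    by (simp add: multilinear_def map_update bundle_endo_linear[OF P 2])
next
  case (3 p)
  have Pp: "P p u \<in> fibre B p" if "u \<in> fibre B p" for u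
    using P 3 that by (auto simp: bundle_endo_def)
  have map_P: "map (P p) vs \<in> tuples k (fibre B p)" if "vs \<in> tuples k (fibre B p)" for vs
    using that Pp by (rule tuples_map)
  have "skew k (fibre B p) (a p)"
    using a 3 by (simp add: wedge_to_tangent_def)
  note skewD[OF this map_P]
  then show ?case
    by (fastforce simp: skew_def map_update tuples_def)
next
  case (4 Ue)
  obtain U e where Ue: "Ue = (U, e)" by fastforce
  then have U: "(U, e) \<in> frames B" using 4 by simp
  have "smooth_vfield_on (base B) U (\<lambda>p. a p (map (P p) (map (\<lambda>i. e i p) is)))"
    if "is": "is \<in> tuples k {..<brank B}" for "is"
  proof -
    have "smooth_section_on B U (\<lambda>p. P p (e i p))" if "i < brank B" for i
      using P U that by (auto simp: bundle_endo_def)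
    then have "smooth_vfield_on (base B) U (\<lambda>p. a p (map (\<lambda>s. s p) (map (\<lambda>i p. P p (e i p)) is)))"
      using "is" by (intro wedge_to_tangent_smooth[OF B a frame_open[OF B U]]) (auto simp: tuples_def)
    then show ?thesis by (simp add: comp_def)
  qed
  then show ?case by (simp add: Ue)
qed

section \<open>Rewriting rules for polynomials in t\<close>

lemma fmult_sum_right: "fmult f (\<Sum>i\<in>I. r i *\<^sub>R x i) = (\<Sum>i\<in>I. r i *\<^sub>R fmult f (x i))"
  by (rule ext) (simp add: fmult_def sum_fun_apply scaleR_sum_right mult.commute)

lemma fmult_sum_left:
  "fmult (\<lambda>p. (\<Sum>i\<in>I. r i *\<^sub>R X i) p f) z = (\<Sum>i\<in>I. r i *\<^sub>R fmult (\<lambda>p. X i p f) z)"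
  by (rule ext) (simp add: fmult_def sum_fun_apply scaleR_sum_left)

lemma polynomial_add_scale:
  fixes c d :: "nat \<Rightarrow> 'w::real_vector" and t :: real
  shows "(\<Sum>k\<le>m. t ^ k *\<^sub>R (c k + r *\<^sub>R d k)) =
    (\<Sum>k\<le>m. t ^ k *\<^sub>R c k) + r *\<^sub>R (\<Sum>k\<le>m. t ^ k *\<^sub>R d k)"
  by (simp add: scaleR_right_distrib sum.distrib scaleR_sum_right mult.commute)

lemma add_scaleR_minus_one: "x + (-1) *\<^sub>R y = x - (y::'w::real_vector)"
  by simp

lemma sum_atMost_split: "(\<Sum>k\<le>m. g k) = g 0 + (\<Sum>k = 1..m. g k)" for m :: nat
  by (simp add: atMost_atLeast0 sum.atLeast_Suc_atMost)

text \<open>Puts the original bracket in degree 0, so that coefficients can be compared; the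
  conditional is there because \<open>\<phi> 0\<close> is unconstrained.\<close>

lemma deformed_bracket_eq:
  "deformed_bracket br m \<phi> t xs = (\<Sum>k\<le>m. t ^ k *\<^sub>R (if k = 0 then br xs else \<phi> k xs))"
proof -
  have "(\<Sum>k = 1..m. t ^ k *\<^sub>R (if k = 0 then br xs else \<phi> k xs)) = (\<Sum>k = 1..m. t ^ k *\<^sub>R \<phi> k xs)"
    by (rule sum.cong) auto
  then show ?thesis
    unfolding deformed_bracket_def sum_atMost_split by (simp only: if_True power_0 scaleR_one simp_thms)
qed

text \<open>Common setting of both directions: N is any bundle map here, and the Nijenhuis condition
  is added in a second locale.\<close>

locale algebroid_endo =
  fixes B :: "('m, 'v::real_vector) vbundle"
    and n :: nat
    and br :: "('m, 'v) bracket"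
    and a :: "('m, 'v) anchor"
    and N :: "'m \<Rightarrow> 'v \<Rightarrow> 'v"
  assumes n: "n \<ge> 2"
    and algebroid: "filippov_algebroid B n br a"
    and N: "bundle_endo B N"
begin

abbreviation "S \<equiv> sections B"
abbreviation "R \<equiv> pre_sections B"
abbreviation "T \<equiv> apply_endo B N"
abbreviation "\<Phi> t \<equiv> apply_endo B (id_plus t N)"
abbreviation "anc \<equiv> apply_anchor B a"
abbreviation "nij \<equiv> nij_bracket B n br N"
text \<open>The candidate symbol of \<open>nij k\<close>, as the coefficient of t^k in the anchor
  evaluated on \<open>\<Phi> t\<close>-images.\<close>

abbreviation "symb \<equiv> insert_sum B N (n - 1) anc"

lemma B: "vector_bundle B"
  and S: "subspace S"
  and br_closed: "\<And>xs. xs \<in> tuples n S \<Longrightarrow> br xs \<in> S"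
  and br_multilinear: "multilinear n S br"
  and br_skew: "skew n S br"
  and br_filippov: "\<And>xs ys. xs \<in> tuples (n - 1) S \<Longrightarrow> ys \<in> tuples n S \<Longrightarrow>
    br (xs @ [br ys]) = (\<Sum>i<n. br (ys[i := br (xs @ [ys ! i])]))"
  and a: "wedge_to_tangent B (n - 1) a"
  and anc_bracket: "\<And>xs ys. xs \<in> tuples (n - 1) S \<Longrightarrow> ys \<in> tuples (n - 1) S \<Longrightarrow>
    lie_bracket (anc xs) (anc ys) = (\<Sum>i<n - 1. anc (ys[i := br (xs @ [ys ! i])]))"
  and br_leibniz: "\<And>xs y f. xs \<in> tuples (n - 1) S \<Longrightarrow> y \<in> S \<Longrightarrow> f \<in> smooth_funs (base B) \<Longrightarrow>
    br (xs @ [fmult f y]) = fmult f (br (xs @ [y])) + fmult (\<lambda>p. anc xs p f) y"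
  using algebroid unfolding filippov_algebroid_def filippov_algebra_def by blast+

lemma S_imp_R: "x \<in> S \<Longrightarrow> x \<in> R"
  by (rule sections_pre[OF B])

lemma R: "subspace R"
  by (rule pre_sections_subspace[OF B])

lemma T_S: "x \<in> S \<Longrightarrow> T x \<in> S"
  by (rule apply_endo_sections[OF B N])

lemma \<Phi>_S: "x \<in> S \<Longrightarrow> \<Phi> t x \<in> S"
  by (rule apply_endo_sections[OF B id_plus_endo[OF B N]])

lemma \<Phi>_eq: "x \<in> R \<Longrightarrow> \<Phi> t x = x + t *\<^sub>R T x"
  by (rule apply_id_plus)

lemma map_\<Phi>: "xs \<in> tuples k S \<Longrightarrow> map (\<Phi> t) xs \<in> tuples k S"
  by (rule tuples_map[OF _ \<Phi>_S])

lemma T_linear: "linear_map_on R T"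
  unfolding linear_map_on_def using R apply_endo_linear[OF N] by blast

lemma \<Phi>_linear: "linear_map_on R (\<Phi> t)"
  unfolding linear_map_on_def using R apply_endo_linear[OF id_plus_endo[OF B N]] by blast

lemma \<Phi>_add_scale: "x \<in> R \<Longrightarrow> y \<in> R \<Longrightarrow> \<Phi> t (x + r *\<^sub>R y) = \<Phi> t x + r *\<^sub>R \<Phi> t y"
  using \<Phi>_linear unfolding linear_map_on_def by blast

lemma \<Phi>_fmult: "x \<in> R \<Longrightarrow> \<Phi> t (fmult f x) = fmult f (\<Phi> t x)"
  by (rule apply_endo_fmult[OF B id_plus_endo[OF B N]])

lemma snoc_S: "xs \<in> tuples (n - 1) S \<Longrightarrow> y \<in> S \<Longrightarrow> xs @ [y] \<in> tuples n S"
  using n by (intro tuples_snoc) auto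

lemma polynomial_S: "(\<And>k. k \<le> m \<Longrightarrow> c k \<in> S) \<Longrightarrow> (\<Sum>k\<le>m. (t::real) ^ k *\<^sub>R c k) \<in> S"
  by (intro subspace_sum[OF S] subspace_scale[OF S]) simp

lemma polynomial_R: "(\<And>k. k \<le> m \<Longrightarrow> c k \<in> R) \<Longrightarrow> (\<Sum>k\<le>m. (t::real) ^ k *\<^sub>R c k) \<in> R"
  by (intro subspace_sum[OF R] subspace_scale[OF R]) simp

lemma nij_Suc: "nij (Suc k) xs = insert_sum B N n br (Suc k) xs - T (nij k xs)"
  by (simp only: insert_sum_def nij_bracket.simps)

lemma nij_closed:
  assumes "xs \<in> tuples n S"
  shows "nij k xs \<in> S"
proof (induction k)
  case 0
  then show ?case using assms br_closed by simp
next
  case (Suc k)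
  have "br (insert_endo B N I xs) \<in> S" for I
    by (intro br_closed insert_endo_tuples[OF B N] assms)
  with Suc T_S show ?case
    unfolding nij_Suc insert_sum_def by (intro subspace_diff[OF S] subspace_sum[OF S]) blast+
qed

text \<open>The coefficients are c_k + T c_(k-1). At the ends only one summand survives: c_0 in
  degree 0 and T c_(n-1) in degree n.\<close>

lemma \<Phi>_polynomial:
  assumes "\<And>k. k \<le> n - 1 \<Longrightarrow> c k \<in> R"
  shows "\<Phi> t (\<Sum>k\<le>n - 1. t ^ k *\<^sub>R c k) =
    (\<Sum>k\<le>n. t ^ k *\<^sub>R ((if k \<le> n - 1 then c k else 0) + (if k = 0 then 0 else T (c (k - 1)))))"
proof -
  have "T (\<Sum>k\<le>n - 1. t ^ k *\<^sub>R c k) = (\<Sum>k\<le>n - 1. t ^ k *\<^sub>R T (c k))"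
    using assms by (intro linear_map_on_sum[OF T_linear]) simp
  then show ?thesis
    using polynomial_shift[where m = "n - 1" and c = c and d = "\<lambda>k. T (c k)"] n
      \<Phi>_eq[OF polynomial_R[OF assms]]
    by simp
qed

lemma br_\<Phi>:
  "xs \<in> tuples n S \<Longrightarrow> br (map (\<Phi> t) xs) = (\<Sum>k\<le>n. t ^ k *\<^sub>R insert_sum B N n br k xs)"
  by (rule multilinear_id_plus[OF B N S br_multilinear])

lemma anc_\<Phi>:
  "xs \<in> tuples (n - 1) S \<Longrightarrow> anc (map (\<Phi> t) xs) = (\<Sum>k\<le>n - 1. t ^ k *\<^sub>R symb k xs)"
  by (rule multilinear_id_plus[OF B N S apply_anchor_multilinear[OF B a]])

text \<open>In degrees k < n the comparison of coefficients is exactly the recursion defining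
  \<open>nij\<close>, which forces c_k = \<open>nij k xs\<close>; degree n then gives the Nijenhuis
  identity.\<close>

lemma nijenhuis_of_hom:
  assumes xs: "xs \<in> tuples n S"
    and c: "\<And>k. k \<le> n - 1 \<Longrightarrow> c k \<in> R"
    and hom: "\<And>t. \<Phi> t (\<Sum>k\<le>n - 1. t ^ k *\<^sub>R c k) = br (map (\<Phi> t) xs)"
  shows "br (map T xs) = T (nij (n - 1) xs)"
proof -
  have "\<Phi> t (\<Sum>k\<le>n - 1. t ^ k *\<^sub>R c k) =
    (\<Sum>k\<le>n. t ^ k *\<^sub>R ((if k \<le> n - 1 then c k else 0) + (if k = 0 then 0 else T (c (k - 1)))))"
    for t
    by (rule \<Phi>_polynomial) (rule c)
  note eq = hom[unfolded this br_\<Phi>[OF xs]]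
  have *: "(if k \<le> n - 1 then c k else 0) + (if k = 0 then 0 else T (c (k - 1))) =
      insert_sum B N n br k xs" if "k \<le> n" for k
    using eq by (rule polynomial_coeffs_eq[OF _ that])
  have "c k = nij k xs" if "k \<le> n - 1" for k
    using that
  proof (induction k)
    case 0
    then show ?case using *[of 0] by (simp add: insert_sum_0)
  next
    case (Suc k)
    then have "c (Suc k) + T (nij k xs) = insert_sum B N n br (Suc k) xs"
      using *[of "Suc k"] by simp
    then show ?case by (simp only: nij_Suc eq_diff_eq)
  qed
  \<comment> \<open>In degree n the left side is T (c (n - 1)) alone, and on the right N sits in
    every slot.\<close>
  then show ?thesis
    using *[of n] n xs by (auto simp: insert_sum_full tuples_def split: if_splits)
qed

section \<open>The candidate symbols and the deformed anchor\<close>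

lemma symb_vector_field: "xs \<in> tuples (n - 1) S \<Longrightarrow> symb k xs \<in> vector_fields (base B)"
  unfolding insert_sum_def
  by (intro vector_fields_sum base_manifold[OF B] apply_anchor_vector_field[OF B a]
      insert_endo_tuples[OF B N])

text \<open>No combinatorics of insertions: \<open>\<Phi> t\<close> acts slot by slot, so skewness
  of the anchor gives an identity between polynomials in t, whose coefficients must agree.\<close>

lemma symb_skew:
  assumes k: "k \<le> n - 1"
  shows "skew (n - 1) S (symb k)"
  unfolding skew_def
proof (intro ballI allI impI)
  fix xs i j assume xs: "xs \<in> tuples (n - 1) S" and ij: "i < j \<and> j < n - 1"
  let ?ys = "xs[i := xs ! j, j := xs ! i]"
  have ys: "?ys \<in> tuples (n - 1) S"
    using xs ij by (intro tuples_update tuples_nth) auto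
  have "anc (map (\<Phi> t) ?ys) = - anc (map (\<Phi> t) xs)" for t
    using skewD[OF apply_anchor_skew[OF B a] map_\<Phi>[OF xs], of i j t] ij xs
    by (simp add: map_update tuples_def)
  then have "(\<Sum>k\<le>n - 1. t ^ k *\<^sub>R symb k ?ys) = (\<Sum>k\<le>n - 1. t ^ k *\<^sub>R (- symb k xs))" for t
    using anc_\<Phi>[OF ys] anc_\<Phi>[OF xs] by (simp add: sum_negf)
  then show "symb k ?ys = - symb k xs"
    by (rule polynomial_coeffs_eq[OF _ k])
qed

text \<open>Again by comparing coefficients, now using that \<open>\<Phi> t\<close> is linear over
  functions.\<close>

lemma symb_linear:
  assumes k: "k \<le> n - 1" and xs: "xs \<in> tuples (n - 1) S" and i: "i < n - 1"
    and y: "y \<in> S" and z: "z \<in> S" and f: "f \<in> smooth_funs (base B)"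
  shows "symb k (xs[i := y + fmult f z]) = symb k (xs[i := y]) + fmult f (symb k (xs[i := z]))"
proof -
  have fz: "fmult f z \<in> S" by (rule fmult_sections[OF B f z])
  have yfz: "y + fmult f z \<in> S" by (rule subspace_add[OF S y fz])
  have "\<Phi> t (y + fmult f z) = \<Phi> t y + fmult f (\<Phi> t z)" for t
    using \<Phi>_add_scale[OF S_imp_R[OF y] S_imp_R[OF fz], of t 1] \<Phi>_fmult[OF S_imp_R[OF z]] by simp
  then have "anc (map (\<Phi> t) (xs[i := y + fmult f z])) =
      anc (map (\<Phi> t) (xs[i := y])) + fmult f (anc (map (\<Phi> t) (xs[i := z])))" for t
    using apply_anchor_linear[OF B a map_\<Phi>[OF xs] i \<Phi>_S[OF y] \<Phi>_S[OF z]]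
    by (simp add: map_update)
  then have "(\<Sum>k\<le>n - 1. t ^ k *\<^sub>R symb k (xs[i := y + fmult f z])) =
      (\<Sum>k\<le>n - 1. t ^ k *\<^sub>R (symb k (xs[i := y]) + fmult f (symb k (xs[i := z]))))" for t
    unfolding anc_\<Phi>[OF tuples_update[OF xs yfz]] anc_\<Phi>[OF tuples_update[OF xs y]]
      anc_\<Phi>[OF tuples_update[OF xs z]]
    by (simp add: scaleR_right_distrib sum.distrib fmult_sum_right)
  then show ?thesis
    by (rule polynomial_coeffs_eq[OF _ k])
qed

text \<open>Precomposition with Id + tN, rather than a polynomial in t, makes this visibly a bundle
  map; its expansion in the symbols is derived on sections.\<close>

definition deformed_anchor :: "real \<Rightarrow> ('m, 'v) anchor" where
  "deformed_anchor t = (\<lambda>p vs. a p (map (id_plus t N p) vs))"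

lemma apply_deformed_anchor: "apply_anchor B (deformed_anchor t) xs = anc (map (\<Phi> t) xs)"
  by (auto simp: apply_anchor_def deformed_anchor_def apply_endo_def comp_def)

lemma apply_deformed_anchor_eq:
  "xs \<in> tuples (n - 1) S \<Longrightarrow>
    apply_anchor B (deformed_anchor t) xs = (\<Sum>k\<le>n - 1. t ^ k *\<^sub>R symb k xs)"
  by (simp only: apply_deformed_anchor anc_\<Phi>)

end

section \<open>The deformation generated by a Nijenhuis operator\<close>

locale nijenhuis_endo = algebroid_endo +
  assumes nijenhuis: "xs \<in> tuples n (sections B) \<Longrightarrow>
    br (map (apply_endo B N) xs) = apply_endo B N (nij_bracket B n br N (n - 1) xs)"
begin

abbreviation "E t \<equiv> deformed_bracket br (n - 1) nij t"

lemma E_eq: "E t xs = (\<Sum>k\<le>n - 1. t ^ k *\<^sub>R nij k xs)"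
  unfolding deformed_bracket_eq by (rule sum.cong) simp_all

lemma E_closed: "xs \<in> tuples n S \<Longrightarrow> E t xs \<in> S"
  unfolding E_eq by (intro polynomial_S nij_closed)

text \<open>The intertwining identity through which all structure is transported. In degrees 0 < k <
  n the term T (nij (k - 1) xs) cancels the subtracted term of the recursion for
  \<open>nij k\<close>.\<close>

lemma \<Phi>_E:
  assumes xs: "xs \<in> tuples n S"
  shows "\<Phi> t (E t xs) = br (map (\<Phi> t) xs)"
proof -
  have "(if k \<le> n - 1 then nij k xs else 0) + (if k = 0 then 0 else T (nij (k - 1) xs)) =
      insert_sum B N n br k xs" if "k \<le> n" for k
  proof -
    show ?thesis
    proof (cases k)
      case 0
      then show ?thesis by (simp add: insert_sum_0)
    next
      case (Suc j)
      show ?thesis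
      proof (cases "k = n")
        \<comment> \<open>Top degree: here the Nijenhuis condition enters.\<close>
        case True
        then show ?thesis
          using n xs nijenhuis[OF xs] by (auto simp: insert_sum_full tuples_def)
      next
        case False
        then have "Suc j \<le> n - 1" using that Suc by simp
        then show ?thesis by (simp add: Suc nij_Suc del: nij_bracket.simps)
      qed
    qed
  qed
  then show ?thesis
    unfolding E_eq \<Phi>_polynomial[OF S_imp_R[OF nij_closed[OF xs]]] br_\<Phi>[OF xs]
    by (intro sum.cong) auto
qed

text \<open>Identities between coefficients may be checked after applying \<open>\<Phi> t\<close>
  for all t. The coefficients range over \<open>R\<close>, not only \<open>S\<close>, to admit the
  terms X(f) z of the Leibniz rule.\<close>

lemma nij_eqI:
  assumes c: "\<And>k. k \<le> n - 1 \<Longrightarrow> c k \<in> R" and d: "\<And>k. k \<le> n - 1 \<Longrightarrow> d k \<in> R"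
    and eq: "\<And>t. \<Phi> t (\<Sum>k\<le>n - 1. t ^ k *\<^sub>R c k) = \<Phi> t (\<Sum>k\<le>n - 1. t ^ k *\<^sub>R d k)"
    and k: "k \<le> n - 1"
  shows "c k = d k"
proof (rule polynomial_cancel_eq[OF T_linear c d _ k])
  fix t :: real
  show "(\<Sum>k\<le>n - 1. t ^ k *\<^sub>R c k) + t *\<^sub>R T (\<Sum>k\<le>n - 1. t ^ k *\<^sub>R c k) =
      (\<Sum>k\<le>n - 1. t ^ k *\<^sub>R d k) + t *\<^sub>R T (\<Sum>k\<le>n - 1. t ^ k *\<^sub>R d k)"
    using eq[of t] c d
    by (simp only: \<Phi>_eq[OF polynomial_R[where c = c]] \<Phi>_eq[OF polynomial_R[where c = d]])
qed

text \<open>After \<open>\<Phi> t\<close> the deformed bracket is the original one on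
  \<open>\<Phi> t\<close>-images, which is multilinear; cancelling \<open>\<Phi> t\<close>
  coefficientwise replaces any induction along the recursion.\<close>

lemma nij_multilinear:
  assumes k: "k \<le> n - 1"
  shows "multilinear n S (nij k)"
  unfolding multilinear_def
proof (intro ballI allI impI)
  fix xs i y z r
  assume xs: "xs \<in> tuples n S" and i: "i < n" and y: "y \<in> S" and z: "z \<in> S"
  have yz: "y + r *\<^sub>R z \<in> S"
    by (intro subspace_add[OF S] subspace_scale[OF S] y z)
  note ty = tuples_update[OF xs y] and tz = tuples_update[OF xs z] and tyz = tuples_update[OF xs yz]
  have "\<Phi> t (\<Sum>k\<le>n - 1. t ^ k *\<^sub>R nij k (xs[i := y + r *\<^sub>R z])) =
      \<Phi> t (\<Sum>k\<le>n - 1. t ^ k *\<^sub>R (nij k (xs[i := y]) + r *\<^sub>R nij k (xs[i := z])))" for t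
  proof -
    have "\<Phi> t (E t (xs[i := y + r *\<^sub>R z])) = \<Phi> t (E t (xs[i := y])) + r *\<^sub>R \<Phi> t (E t (xs[i := z]))"
      unfolding \<Phi>_E[OF ty] \<Phi>_E[OF tz] \<Phi>_E[OF tyz]
      using multilinearD[OF br_multilinear map_\<Phi>[OF xs] i \<Phi>_S[OF y] \<Phi>_S[OF z]]
      by (simp add: map_update \<Phi>_add_scale S_imp_R y z)
    also have "\<dots> = \<Phi> t (E t (xs[i := y]) + r *\<^sub>R E t (xs[i := z]))"
      by (intro \<Phi>_add_scale[symmetric] S_imp_R E_closed ty tz)
    finally show ?thesis
      unfolding polynomial_add_scale E_eq .
  qed
  then show "nij k (xs[i := y + r *\<^sub>R z]) = nij k (xs[i := y]) + r *\<^sub>R nij k (xs[i := z])"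
    by (rule nij_eqI[OF _ _ _ k, rotated 2])
      (intro S_imp_R subspace_add[OF S] subspace_scale[OF S] nij_closed ty tz tyz)+
qed

lemma nij_skew:
  assumes k: "k \<le> n - 1"
  shows "skew n S (nij k)"
  unfolding skew_def
proof (intro ballI allI impI)
  fix xs i j assume xs: "xs \<in> tuples n S" and ij: "i < j \<and> j < n"
  let ?ys = "xs[i := xs ! j, j := xs ! i]"
  have ys: "?ys \<in> tuples n S"
    using xs ij by (intro tuples_update tuples_nth) auto
  \<comment> \<open>The negative is written 0 + (-1) times the bracket to fit
    \<open>polynomial_add_scale\<close> and \<open>\<Phi>_add_scale\<close>.\<close>
  have "\<Phi> t (\<Sum>k\<le>n - 1. t ^ k *\<^sub>R nij k ?ys) = \<Phi> t (\<Sum>k\<le>n - 1. t ^ k *\<^sub>R (0 + (-1) *\<^sub>R nij k xs))" for t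
  proof -
    have "\<Phi> t (E t ?ys) = - \<Phi> t (E t xs)"
      unfolding \<Phi>_E[OF xs] \<Phi>_E[OF ys]
      using skewD[OF br_skew map_\<Phi>[OF xs], of i j t] ij xs
      by (simp add: map_update tuples_def)
    also have "\<dots> = \<Phi> t (0 + (-1) *\<^sub>R E t xs)"
      using \<Phi>_add_scale[OF subspace_0[OF R] S_imp_R[OF E_closed[OF xs]], of t "-1" t]
        linear_map_on_zero[OF \<Phi>_linear]
      by simp
    finally show ?thesis
      unfolding polynomial_add_scale E_eq by simp
  qed
  then have "nij k ?ys = 0 + (-1) *\<^sub>R nij k xs"
    by (rule nij_eqI[OF _ _ _ k, rotated 2])
      (intro S_imp_R subspace_add[OF S] subspace_scale[OF S] subspace_0[OF S] nij_closed ys xs)+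
  then show "nij k ?ys = - nij k xs" by simp
qed

text \<open>The original Leibniz rule on \<open>\<Phi> t\<close>-images has anchor term X(f) times
  \<open>\<Phi> t z\<close>, where X has the coefficients \<open>symb k xs\<close>. Since
  \<open>\<Phi> t\<close> commutes with multiplication by functions, it can be pulled out of both
  terms and cancelled.\<close>

lemma nij_leibniz:
  assumes k: "k \<le> n - 1" and xs: "xs \<in> tuples (n - 1) S" and z: "z \<in> S"
    and f: "f \<in> smooth_funs (base B)"
  shows "nij k (xs @ [fmult f z]) = fmult f (nij k (xs @ [z])) + fmult (\<lambda>p. symb k xs p f) z"
proof -
  have fz: "fmult f z \<in> S" by (rule fmult_sections[OF B f z])
  note txz = snoc_S[OF xs z] and txfz = snoc_S[OF xs fz]
  have r: "fmult g z \<in> R" "fmult f (nij k (xs @ [z])) \<in> R" for g k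
    by (intro fmult_pre[OF B] S_imp_R z nij_closed txz)+
  have "\<Phi> t (\<Sum>k\<le>n - 1. t ^ k *\<^sub>R nij k (xs @ [fmult f z])) =
      \<Phi> t (\<Sum>k\<le>n - 1. t ^ k *\<^sub>R (fmult f (nij k (xs @ [z])) + 1 *\<^sub>R fmult (\<lambda>p. symb k xs p f) z))"
    (is "?l t = ?r t") for t
  proof -
    let ?A = "anc (map (\<Phi> t) xs)"
    have "?l t = br (map (\<Phi> t) (xs @ [fmult f z]))"
      using \<Phi>_E[OF txfz, of t] unfolding E_eq .
    also have "\<dots> = br (map (\<Phi> t) xs @ [fmult f (\<Phi> t z)])"
      by (simp add: \<Phi>_fmult S_imp_R z)
    also have "\<dots> = fmult f (\<Phi> t (E t (xs @ [z]))) + fmult (\<lambda>p. ?A p f) (\<Phi> t z)"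
      unfolding \<Phi>_E[OF txz] br_leibniz[OF map_\<Phi>[OF xs] \<Phi>_S[OF z] f] by simp
    \<comment> \<open>The factor 1 only brings the sum into the shape of
      \<open>\<Phi>_add_scale\<close>.\<close>
    also have "\<dots> = \<Phi> t (fmult f (E t (xs @ [z]))) + 1 *\<^sub>R \<Phi> t (fmult (\<lambda>p. ?A p f) z)"
      by (simp only: \<Phi>_fmult[OF S_imp_R[OF E_closed[OF txz]]] \<Phi>_fmult[OF S_imp_R[OF z]] scaleR_one)
    also have "\<dots> = \<Phi> t (fmult f (E t (xs @ [z])) + 1 *\<^sub>R fmult (\<lambda>p. ?A p f) z)"
      by (intro \<Phi>_add_scale[symmetric] fmult_pre[OF B] S_imp_R z E_closed txz)
    also have "\<dots> = ?r t"
      unfolding polynomial_add_scale E_eq anc_\<Phi>[OF xs] fmult_sum_right fmult_sum_left ..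
    finally show ?thesis .
  qed
  then have "nij k (xs @ [fmult f z]) = fmult f (nij k (xs @ [z])) + 1 *\<^sub>R fmult (\<lambda>p. symb k xs p f) z"
    by (rule nij_eqI[OF _ _ _ k, rotated 2])
      (intro S_imp_R[OF nij_closed] txfz subspace_add[OF R] subspace_scale[OF R] r)+
  then show ?thesis by simp
qed

lemma nij_has_symbol: "k \<le> n - 1 \<Longrightarrow> has_symbol B n (nij k) (symb k)"
  unfolding has_symbol_def
  by (intro conjI ballI allI impI symb_vector_field symb_skew symb_linear nij_leibniz)

lemma nij_Der1: "k \<le> n - 1 \<Longrightarrow> nij k \<in> Der1 B n"
  unfolding Der1_def mem_Collect_eq
  by (intro conjI ballI exI[of _ "symb k"] nij_closed nij_multilinear nij_skew nij_has_symbol)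

text \<open>In a nested bracket the inner value itself varies with t. Multilinearity of each
  \<open>nij k\<close> expands it, so the outer bracket is again polynomial in t.\<close>

lemma polynomial_path_E:
  assumes ws: "ws \<in> tuples n S" and i: "i < n" and W: "polynomial_path S W"
  shows "polynomial_path S (\<lambda>t. E t (ws[i := W t]))"
proof -
  obtain m c where c: "\<forall>k. c k \<in> S" "\<forall>t. W t = (\<Sum>k\<le>m. t ^ k *\<^sub>R c k)"
    using W unfolding polynomial_path_def by blast
  have "nij k (ws[i := W t]) = (\<Sum>j\<le>m. t ^ j *\<^sub>R nij k (ws[i := c j]))" if "k \<le> n - 1" for k t
    unfolding c(2)[rule_format]
    by (rule multilinear_sum[OF nij_multilinear[OF that] ws i S]) (use c(1) in blast)
  then have "E t (ws[i := W t]) =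
      (\<Sum>k\<le>n - 1. t ^ k *\<^sub>R (\<Sum>j\<le>m. t ^ j *\<^sub>R nij k (ws[i := c j])))" for t
    unfolding E_eq by (intro sum.cong refl) simp
  moreover have "polynomial_path S
      (\<lambda>t. \<Sum>k\<le>n - 1. t ^ k *\<^sub>R (\<Sum>j\<le>m. t ^ j *\<^sub>R nij k (ws[i := c j])))"
  proof (rule polynomial_path_sum[OF S], rule polynomial_path_times_power[OF S],
      rule polynomial_path_sum[OF S], rule polynomial_path_times_power[OF S],
      rule polynomial_path_const[OF S])
    show "nij k (ws[i := c j]) \<in> S" for k j
      using nij_closed[OF tuples_update[OF ws]] c(1) by blast
  qed
  ultimately show ?thesis by simp
qed

lemma E_path: "xs \<in> tuples n S \<Longrightarrow> polynomial_path S (\<lambda>t. E t xs)"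
  unfolding E_eq by (rule polynomial_pathI[OF S nij_closed]) auto

text \<open>Under \<open>\<Phi> t\<close> both sides become the two sides of the original Filippov
  identity on \<open>\<Phi> t\<close>-images. Their difference is a polynomial path, so
  \<open>\<Phi> t\<close> cancels even at values of t where it is not injective.\<close>

lemma E_filippov:
  assumes xs: "xs \<in> tuples (n - 1) S" and ys: "ys \<in> tuples n S"
  shows "E t (xs @ [E t ys]) = (\<Sum>i<n. E t (ys[i := E t (xs @ [ys ! i])]))"
proof -
  have len: "length xs = n - 1" "length ys = n"
    using xs ys by (auto simp: tuples_def)
  have ysi: "ys ! i \<in> S" if "i < n" for i
    using tuples_nth[OF ys that] .
  note txy = snoc_S[OF xs ysi]
  have txE: "xs @ [E t ys] \<in> tuples n S" for t
    by (rule snoc_S[OF xs E_closed[OF ys]])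
  have tyE: "ys[i := E t (xs @ [ys ! i])] \<in> tuples n S" if "i < n" for i t
    by (rule tuples_update[OF ys E_closed[OF txy[OF that]]])
  define P where "P t = E t (xs @ [E t ys]) + (-1) *\<^sub>R (\<Sum>i<n. E t (ys[i := E t (xs @ [ys ! i])]))"
    for t
  \<comment> \<open>\<open>polynomial_path_E\<close> varies a slot of a fixed tuple; 0 is a
    placeholder in the last slot, which has index n - 1.\<close>
  have "xs @ [E t ys] = (xs @ [0])[n - 1 := E t ys]" for t
    using len by (simp add: list_update_append)
  then have "polynomial_path S (\<lambda>t. E t (xs @ [E t ys]))"
    using polynomial_path_E[OF snoc_S[OF xs subspace_0[OF S]] _ E_path[OF ys], of "n - 1"] n
    by simp
  moreover have "polynomial_path S (\<lambda>t. \<Sum>i<n. E t (ys[i := E t (xs @ [ys ! i])]))"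
    by (intro polynomial_path_sum[OF S] polynomial_path_E[OF ys] E_path txy) auto
  ultimately have P: "polynomial_path S P"
    unfolding P_def by (rule polynomial_path_add_scale[OF S])
  have "P t + t *\<^sub>R T (P t) = 0" for t
  proof -
    have sum_S: "(\<Sum>i<n. E t (ys[i := E t (xs @ [ys ! i])])) \<in> S"
      by (intro subspace_sum[OF S] E_closed tyE) simp
    have "P t \<in> S"
      unfolding P_def by (intro subspace_add[OF S] subspace_scale[OF S] sum_S E_closed txE)
    then have "P t + t *\<^sub>R T (P t) = \<Phi> t (P t)"
      using \<Phi>_eq[OF S_imp_R] by simp
    also have "\<dots> = \<Phi> t (E t (xs @ [E t ys])) + (-1) *\<^sub>R \<Phi> t (\<Sum>i<n. E t (ys[i := E t (xs @ [ys ! i])]))"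
      unfolding P_def by (intro \<Phi>_add_scale S_imp_R sum_S E_closed txE)
    also have "\<Phi> t (\<Sum>i<n. E t (ys[i := E t (xs @ [ys ! i])])) =
        (\<Sum>i<n. \<Phi> t (E t (ys[i := E t (xs @ [ys ! i])])))"
      using linear_map_on_sum[OF \<Phi>_linear, where c = "\<lambda>_. 1" and I = "{..<n}"
          and v = "\<lambda>i. E t (ys[i := E t (xs @ [ys ! i])])"] S_imp_R[OF E_closed[OF tyE]] by simp
    \<comment> \<open>\<open>\<Phi>_E\<close> is used twice, on the outer bracket and on the inner
      one in slot \<open>i\<close>.\<close>
    also have "\<dots> = (\<Sum>i<n. br ((map (\<Phi> t) ys)[i := br (map (\<Phi> t) xs @ [map (\<Phi> t) ys ! i])]))"
    proof (rule sum.cong[OF refl])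
      fix i assume "i \<in> {..<n}"
      then have i: "i < n" by simp
      show "\<Phi> t (E t (ys[i := E t (xs @ [ys ! i])])) =
          br ((map (\<Phi> t) ys)[i := br (map (\<Phi> t) xs @ [map (\<Phi> t) ys ! i])])"
        unfolding \<Phi>_E[OF tyE[OF i]] map_update \<Phi>_E[OF txy[OF i]] using i len by simp
    qed
    also have "\<Phi> t (E t (xs @ [E t ys])) = br (map (\<Phi> t) xs @ [br (map (\<Phi> t) ys)])"
      unfolding \<Phi>_E[OF txE] map_append list.map \<Phi>_E[OF ys] ..
    also have "\<dots> = (\<Sum>i<n. br ((map (\<Phi> t) ys)[i := br (map (\<Phi> t) xs @ [map (\<Phi> t) ys ! i])]))"
      by (rule br_filippov[OF map_\<Phi>[OF xs] map_\<Phi>[OF ys]])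
    finally show ?thesis
      unfolding add_scaleR_minus_one diff_self .
  qed
  note z = this
  have "linear_map_on S T"
    using T_linear S_imp_R S unfolding linear_map_on_def by blast
  then have "P t = 0"
    using P z by (rule polynomial_path_cancel)
  then show ?thesis
    unfolding P_def add_scaleR_minus_one right_minus_eq .
qed

lemma E_multilinear: "multilinear n S (E t)"
  unfolding multilinear_def
proof (intro ballI allI impI)
  fix xs i y z r
  assume "xs \<in> tuples n S" "i < n" "y \<in> S" "z \<in> S"
  then have "nij k (xs[i := y + r *\<^sub>R z]) = nij k (xs[i := y]) + r *\<^sub>R nij k (xs[i := z])"
    if "k \<le> n - 1" for k
    using multilinearD[OF nij_multilinear[OF that]] by blast
  then show "E t (xs[i := y + r *\<^sub>R z]) = E t (xs[i := y]) + r *\<^sub>R E t (xs[i := z])"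
    unfolding E_eq polynomial_add_scale[symmetric] by (intro sum.cong refl) simp
qed

lemma E_skew: "skew n S (E t)"
  unfolding skew_def
proof (intro ballI allI impI)
  fix xs i j assume "xs \<in> tuples n S" "i < j \<and> j < n"
  then have "nij k (xs[i := xs ! j, j := xs ! i]) = - nij k xs" if "k \<le> n - 1" for k
    using skewD[OF nij_skew[OF that]] by blast
  then show "E t (xs[i := xs ! j, j := xs ! i]) = - E t xs"
    unfolding E_eq sum_negf[symmetric] by (intro sum.cong refl) simp
qed

text \<open>The anchor identity takes values in vector fields and holds for each t directly: it is
  the original identity on \<open>\<Phi> t\<close>-images, with \<open>\<Phi>_E\<close> rewriting
  the inner brackets. The Leibniz rule is the sum over k of \<open>nij_leibniz\<close>.\<close>

lemma deformed_algebroid: "filippov_algebroid B n (E t) (deformed_anchor t)"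
  unfolding filippov_algebroid_def filippov_algebra_def
proof (intro conjI ballI)
  show "wedge_to_tangent B (n - 1) (deformed_anchor t)"
    unfolding deformed_anchor_def by (rule wedge_to_tangent_endo[OF B a id_plus_endo[OF B N]])
next
  fix xs ys assume xs: "xs \<in> tuples (n - 1) S" and ys: "ys \<in> tuples (n - 1) S"
  have "br (map (\<Phi> t) xs @ [map (\<Phi> t) ys ! i]) = \<Phi> t (E t (xs @ [ys ! i]))" if "i < n - 1" for i
    using \<Phi>_E[OF snoc_S[OF xs tuples_nth[OF ys that]], of t] that ys
    by (simp add: tuples_def del: nij_bracket.simps)
  then show "lie_bracket (apply_anchor B (deformed_anchor t) xs) (apply_anchor B (deformed_anchor t) ys) =
      (\<Sum>i<n - 1. apply_anchor B (deformed_anchor t) (ys[i := E t (xs @ [ys ! i])]))"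
    unfolding apply_deformed_anchor anc_bracket[OF map_\<Phi>[OF xs] map_\<Phi>[OF ys]] map_update
    by (intro sum.cong refl) simp
next
  fix xs y f assume xs: "xs \<in> tuples (n - 1) S" and y: "y \<in> S" and f: "f \<in> smooth_funs (base B)"
  have "E t (xs @ [fmult f y]) =
      (\<Sum>k\<le>n - 1. t ^ k *\<^sub>R (fmult f (nij k (xs @ [y])) + 1 *\<^sub>R fmult (\<lambda>p. symb k xs p f) y))"
    unfolding E_eq by (intro sum.cong refl) (simp add: nij_leibniz[OF _ xs y f])
  also have "\<dots> = (\<Sum>k\<le>n - 1. t ^ k *\<^sub>R fmult f (nij k (xs @ [y]))) +
      (\<Sum>k\<le>n - 1. t ^ k *\<^sub>R fmult (\<lambda>p. symb k xs p f) y)"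
    by (simp only: scaleR_right_distrib sum.distrib scaleR_one)
  finally show "E t (xs @ [fmult f y]) = fmult f (E t (xs @ [y])) +
      fmult (\<lambda>p. apply_anchor B (deformed_anchor t) xs p f) y"
    unfolding apply_deformed_anchor_eq[OF xs] fmult_sum_left E_eq
      fmult_sum_right .
qed (assumption | rule B S E_closed E_multilinear E_skew E_filippov)+

lemma deformation: "deformation B n br a (n - 1) nij deformed_anchor"
  unfolding deformation_def
proof (rule conjI[OF _ conjI])
  show "\<forall>i\<in>{1..n - 1}. nij i \<in> Der1 B n"
    by (intro ballI nij_Der1) simp
  show "\<forall>t. filippov_algebroid B n (E t) (deformed_anchor t)"
    by (intro allI deformed_algebroid)
  have 1: "\<forall>i\<in>{1..n - 1}. has_symbol B n (nij i) (symb i)"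
    by (intro ballI nij_has_symbol) simp
  have 2: "\<forall>t. \<forall>xs\<in>tuples (n - 1) S.
      apply_anchor B (deformed_anchor t) xs = anc xs + (\<Sum>i = 1..n - 1. t ^ i *\<^sub>R symb i xs)"
  proof (intro allI ballI)
    fix t xs assume xs: "xs \<in> tuples (n - 1) S"
    \<comment> \<open>\<open>symb 0\<close> is the original anchor, split off as the term of degree
      0.\<close>
    show "apply_anchor B (deformed_anchor t) xs = anc xs + (\<Sum>i = 1..n - 1. t ^ i *\<^sub>R symb i xs)"
      unfolding apply_deformed_anchor_eq[OF xs] sum_atMost_split insert_sum_0 power_0 scaleR_one ..
  qed
  show "\<exists>\<sigma>. (\<forall>i\<in>{1..n - 1}. has_symbol B n (nij i) (\<sigma> i)) \<and>
      (\<forall>t. \<forall>xs\<in>tuples (n - 1) S.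
        apply_anchor B (deformed_anchor t) xs = anc xs + (\<Sum>i = 1..n - 1. t ^ i *\<^sub>R \<sigma> i xs))"
    by (rule exI[of _ symb]) (rule conjI[OF 1 2])
qed

lemma trivial_through: "trivial_through B n br a (n - 1) nij deformed_anchor N"
  unfolding trivial_through_def filippov_hom_def
proof (intro conjI allI ballI)
  show "\<Phi> t (E t xs) = br (map (\<Phi> t) xs)" if "xs \<in> tuples n S" for t xs
    using that by (rule \<Phi>_E)
qed (rule N id_plus_endo[OF B N] apply_deformed_anchor[symmetric])+

end

section \<open>From a trivial deformation to a Nijenhuis operator, and both directions
  together\<close>

lemma (in algebroid_endo) nijenhuis_of_trivial_through:
  assumes D: "deformation B n br a (n - 1) \<phi> aa"
    and triv: "trivial_through B n br a (n - 1) \<phi> aa N"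
  shows "nijenhuis_operator B n br N"
  unfolding nijenhuis_operator_def
proof (intro conjI ballI)
  show "bundle_endo B N" by (rule N)
  fix xs assume xs: "xs \<in> tuples n S"
  \<comment> \<open>The coefficients are the original bracket in degree 0 and the generators above
    it; the latter are sections because they lie in \<open>Der1\<close>.\<close>
  show "br (map T xs) = T (nij (n - 1) xs)"
  proof (rule nijenhuis_of_hom[OF xs, where c = "\<lambda>k. if k = 0 then br xs else \<phi> k xs"])
    fix k assume k: "k \<le> n - 1"
    show "(if k = 0 then br xs else \<phi> k xs) \<in> R"
    proof (cases "k = 0")
      case False
      then have "k \<in> {1..n - 1}" using k by simp
      then have "\<phi> k \<in> Der1 B n"
        using D unfolding deformation_def by blast
      then have "\<phi> k xs \<in> S"
        using xs unfolding Der1_def by blast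
      then show ?thesis using False S_imp_R by simp
    qed (use S_imp_R[OF br_closed[OF xs]] in simp)
  next
    fix t
    show "\<Phi> t (\<Sum>k\<le>n - 1. t ^ k *\<^sub>R (if k = 0 then br xs else \<phi> k xs)) = br (map (\<Phi> t) xs)"
      using triv xs unfolding trivial_through_def filippov_hom_def deformed_bracket_eq by blast
  qed
qed

theorem theorem4p8:
  fixes B :: "('m, 'v::real_vector) vbundle"
    and n :: nat
    and br :: "('m, 'v) bracket"
    and a :: "('m, 'v) anchor"
  assumes "n \<ge> 2"
    and "filippov_algebroid B n br a"
  shows "(\<forall>\<phi> aa N.
            deformation B n br a (n - 1) \<phi> aa \<and> trivial_through B n br a (n - 1) \<phi> aa N \<longrightarrow>
            nijenhuis_operator B n br N) \<and>
         (\<forall>N. nijenhuis_operator B n br N \<longrightarrow>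
            (\<forall>i\<in>{1..n - 1}. nij_bracket B n br N i \<in> Der1 B n) \<and>
            (\<exists>aa. trivial_deformation B n br a (n - 1) (nij_bracket B n br N) aa))"
proof (intro conjI allI impI)
  fix \<phi> aa N
  assume D: "deformation B n br a (n - 1) \<phi> aa \<and> trivial_through B n br a (n - 1) \<phi> aa N"
  then have "bundle_endo B N"
    unfolding trivial_through_def by blast
  then interpret algebroid_endo B n br a N
    by (rule algebroid_endo.intro[OF assms])
  show "nijenhuis_operator B n br N"
    using D nijenhuis_of_trivial_through by blast
next
  fix N assume nij_op: "nijenhuis_operator B n br N"
  then have "bundle_endo B N"
    unfolding nijenhuis_operator_def by blast
  then interpret algebroid_endo B n br a N
    by (rule algebroid_endo.intro[OF assms])
  have "\<forall>xs\<in>tuples n (sections B).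
      br (map (apply_endo B N) xs) = apply_endo B N (nij_bracket B n br N (n - 1) xs)"
    using nij_op unfolding nijenhuis_operator_def by blast
  then interpret nijenhuis_endo B n br a N
    by unfold_locales (rule bspec)
  show "\<forall>i\<in>{1..n - 1}. nij_bracket B n br N i \<in> Der1 B n"
    by (intro ballI nij_Der1) simp
  \<comment> \<open>The witnesses are \<open>deformed_anchor\<close> for the anchors and N itself
    for the trivialising map.\<close>
  show "\<exists>aa. trivial_deformation B n br a (n - 1) (nij_bracket B n br N) aa"
    unfolding trivial_deformation_def using deformation trivial_through by blast
qed

end
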